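(* Let $q>3$ be a rational prime, let $p\equiv 1 \pmod 3$ be a prime with $p\neq q$, and let $L,M$ be integers with $4p=L^2+27M^2$. If $q\equiv \pm 2 \pmod 9$, then $F_q(L,M)=\omega$ if and only if there is an integer $t$ with $$(t^3-3t^2-9t+3)\,L \equiv -3\,(t^3+9t^2-9t-9)\,M \pmod q .$$ If $q\equiv \pm 4 \pmod 9$, then $F_q(L,M)=\omega$ if and only if there is an integer $t$ with $$(t^3-3t^2-9t+3)\,L \equiv 3\,(t^3+9t^2-9t-9)\,M \pmod q .$$
   Context: Let $\omega=e^{2\pi i/3}$ and $R=\mathbb{Z}[\omega]$. A rational prime is a positive prime of $\mathbb{Z}$. A prime element $\pi=a+b\omega\in R$ ($a,b\in\mathbb{Z}$) is called primary if $3\mid b$. If $p\equiv 1\pmod 3$ is a rational prime and $\pi\in R$ is a primary prime with $\pi\bar\pi=p$, the cubic residue character $\chi_\pi$ is defined on $R$ by $\chi_\pi(\alpha)=0$ if $\pi\mid\alpha$, and otherwise $\chi_\pi(\alpha)$ is the unique element of $\{1,\omega,\bar\omega\}$ with $\alpha^{(p-1)/3}\equiv\chi_\pi(\alpha)\pmod \pi$. If $L,M$ are integers with $4p=L^2+27M^2$ for a prime $p\equiv 1\pmod 3$, set $a=\tfrac12(L+3M)$, $b=3M$ (so $L=2a-b$, $M=b/3$); then $a,b$ are integers and $\pi=a+b\omega$ is a primary prime with $\pi\bar\pi=p$. For a rational prime $q$ define $F_q(L,M)=\chi_\pi(q)$. *)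

theory Defs
  imports "HOL-Analysis.Analysis" "HOL-Number_Theory.Number_Theory"
begin

definition omega_c :: complex
  where "omega_c = exp (2 * of_real pi * \<i> / 3)"

lemma omega_c_explicit: "omega_c = Complex (-1/2) (sqrt 3 / 2)"
proof -
  have "omega_c = cis (2 * pi / 3)"
    by (simp add: omega_c_def cis_conv_exp mult_ac)
  then show ?thesis
    by (simp add: complex_eq_iff cos_120 sin_120)
qed

lemma omega_c_square: "omega_c * omega_c = -1 - omega_c"
  by (simp add: omega_c_explicit complex_eq_iff)

lemma cnj_omega_c: "cnj omega_c = -1 - omega_c"
  by (simp add: omega_c_explicit complex_eq_iff)

typedef eisenstein = "{z. \<exists>a b :: int. z = of_int a + of_int b * omega_c}"
  morphisms eis_complex Eis
  by auto

setup_lifting type_definition_eisenstein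

instantiation eisenstein :: idom
begin

lift_definition zero_eisenstein :: eisenstein is "0 :: complex"
  by (rule exI[of _ 0], rule exI[of _ 0]) simp

lift_definition one_eisenstein :: eisenstein is "1 :: complex"
  by (rule exI[of _ 1], rule exI[of _ 0]) simp

lift_definition plus_eisenstein :: "eisenstein \<Rightarrow> eisenstein \<Rightarrow> eisenstein"
  is "(+) :: complex \<Rightarrow> complex \<Rightarrow> complex"
proof -
  fix x y :: complex
  assume "\<exists>a b :: int. x = of_int a + of_int b * omega_c"
    and "\<exists>a b :: int. y = of_int a + of_int b * omega_c"
  then obtain a b c d :: int where "x = of_int a + of_int b * omega_c"
    and "y = of_int c + of_int d * omega_c" by blast
  then have "x + y = of_int (a + c) + of_int (b + d) * omega_c"
    by (simp add: algebra_simps)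
  then show "\<exists>a b :: int. x + y = of_int a + of_int b * omega_c" by blast
qed

lift_definition uminus_eisenstein :: "eisenstein \<Rightarrow> eisenstein"
  is "uminus :: complex \<Rightarrow> complex"
proof -
  fix x :: complex
  assume "\<exists>a b :: int. x = of_int a + of_int b * omega_c"
  then obtain a b :: int where "x = of_int a + of_int b * omega_c" by blast
  then have "- x = of_int (- a) + of_int (- b) * omega_c"
    by (simp add: algebra_simps)
  then show "\<exists>a b :: int. - x = of_int a + of_int b * omega_c" by blast
qed

lift_definition minus_eisenstein :: "eisenstein \<Rightarrow> eisenstein \<Rightarrow> eisenstein"
  is "(-) :: complex \<Rightarrow> complex \<Rightarrow> complex"
proof -
  fix x y :: complex
  assume "\<exists>a b :: int. x = of_int a + of_int b * omega_c"
    and "\<exists>a b :: int. y = of_int a + of_int b * omega_c"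
  then obtain a b c d :: int where "x = of_int a + of_int b * omega_c"
    and "y = of_int c + of_int d * omega_c" by blast
  then have "x - y = of_int (a - c) + of_int (b - d) * omega_c"
    by (simp add: algebra_simps)
  then show "\<exists>a b :: int. x - y = of_int a + of_int b * omega_c" by blast
qed

lift_definition times_eisenstein :: "eisenstein \<Rightarrow> eisenstein \<Rightarrow> eisenstein"
  is "(*) :: complex \<Rightarrow> complex \<Rightarrow> complex"
proof -
  fix x y :: complex
  assume "\<exists>a b :: int. x = of_int a + of_int b * omega_c"
    and "\<exists>a b :: int. y = of_int a + of_int b * omega_c"
  then obtain a b c d :: int where "x = of_int a + of_int b * omega_c"
    and "y = of_int c + of_int d * omega_c" by blast
  then have "x * y = of_int (a * c) + of_int (a * d + b * c) * omega_c
                      + of_int (b * d) * (omega_c * omega_c)"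
    by (simp add: algebra_simps)
  also have "\<dots> = of_int (a * c - b * d) + of_int (a * d + b * c - b * d) * omega_c"
    unfolding omega_c_square by (simp add: algebra_simps)
  finally show "\<exists>a b :: int. x * y = of_int a + of_int b * omega_c" by blast
qed

instance
  by standard (transfer; simp add: algebra_simps)+

end

lift_definition omega :: eisenstein is omega_c
  by (rule exI[of _ 0], rule exI[of _ 1]) simp

lift_definition eis_cnj :: "eisenstein \<Rightarrow> eisenstein" is cnj
proof -
  fix x :: complex
  assume "\<exists>a b :: int. x = of_int a + of_int b * omega_c"
  then obtain a b :: int where "x = of_int a + of_int b * omega_c" by blast
  then have "cnj x = of_int (a - b) + of_int (- b) * omega_c"
    by (simp add: cnj_omega_c algebra_simps)
  then show "\<exists>a b :: int. cnj x = of_int a + of_int b * omega_c" by blast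
qed

lemma eis_complex_of_nat [simp]: "eis_complex (of_nat n) = of_nat n"
  by (induction n) (simp_all add: zero_eisenstein.rep_eq one_eisenstein.rep_eq
        plus_eisenstein.rep_eq)

lemma eis_complex_of_int [simp]: "eis_complex (of_int n) = of_int n"
  by (cases n rule: int_diff_cases) (simp add: minus_eisenstein.rep_eq)

lemma of_int_eisenstein_inject: "(of_int m :: eisenstein) = of_int n \<longleftrightarrow> m = n"
  by (metis eis_complex_of_int of_int_eq_iff)

lemma eisenstein_cases:
  obtains a b :: int where "x = of_int a + of_int b * omega"
proof -
  obtain a b :: int where "eis_complex x = of_int a + of_int b * omega_c"
    using eis_complex[of x] by blast
  then have "eis_complex x = eis_complex (of_int a + of_int b * omega)"
    by (simp add: plus_eisenstein.rep_eq times_eisenstein.rep_eq omega.rep_eq)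
  then show ?thesis using that eis_complex_inject by blast
qed

lemma omega_square: "omega * omega = -1 - omega"
  by transfer (rule omega_c_square)

lemma eis_cnj_omega: "eis_cnj omega = -1 - omega"
  by transfer (rule cnj_omega_c)

lemma eis_cnj_coords:
  "eis_cnj (of_int a + of_int b * omega) = of_int (a - b) - of_int b * omega"
proof -
  have "eis_complex (eis_cnj (of_int a + of_int b * omega))
      = eis_complex (of_int (a - b) - of_int b * omega)"
    by (simp add: eis_cnj.rep_eq plus_eisenstein.rep_eq times_eisenstein.rep_eq
        minus_eisenstein.rep_eq omega.rep_eq cnj_omega_c algebra_simps)
  then show ?thesis using eis_complex_inject by blast
qed

lemma mult_eis_cnj_coords:
  "(of_int a + of_int b * omega) * eis_cnj (of_int a + of_int b * omega)
     = of_int (a\<^sup>2 - a * b + b\<^sup>2)"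
proof -
  have "(of_int a + of_int b * omega) * eis_cnj (of_int a + of_int b * omega)
      = of_int a * of_int (a - b) + of_int b * of_int (a - b) * omega
        - of_int a * of_int b * omega - of_int b * of_int b * (omega * omega)"
    unfolding eis_cnj_coords by (simp only: algebra_simps)
  also have "\<dots> = of_int (a\<^sup>2 - a * b + b\<^sup>2)"
    unfolding omega_square by (simp add: algebra_simps power2_eq_square)
  finally show ?thesis .
qed

text \<open>The squared modulus is always a nonnegative integer, so \<open>floor\<close> and \<open>nat\<close> lose nothing;
  see \<open>eis_norm_correct\<close>.\<close>

definition eis_norm :: "eisenstein \<Rightarrow> nat"
  where "eis_norm x = nat \<lfloor>(cmod (eis_complex x))\<^sup>2\<rfloor>"

lemma eis_norm_correct: "of_nat (eis_norm x) = x * eis_cnj x"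
proof -
  obtain a b where x: "x = of_int a + of_int b * omega" by (rule eisenstein_cases)
  define n where "n = a\<^sup>2 - a * b + b\<^sup>2"
  have xn: "x * eis_cnj x = of_int n"
    unfolding x n_def by (rule mult_eis_cnj_coords)
  then have "eis_complex x * cnj (eis_complex x) = of_int n"
    by (metis eis_cnj.rep_eq eis_complex_of_int times_eisenstein.rep_eq)
  then have "complex_of_real ((cmod (eis_complex x))\<^sup>2) = complex_of_real (of_int n)"
    by (simp only: complex_norm_square of_real_of_int_eq)
  then have c: "(cmod (eis_complex x))\<^sup>2 = of_int n"
    by (simp only: of_real_eq_iff)
  have "0 \<le> real_of_int n" unfolding c[symmetric] by simp
  then have "0 \<le> n" by simp
  moreover have "eis_norm x = nat n" by (simp add: eis_norm_def c)
  ultimately have "(of_nat (eis_norm x) :: eisenstein) = of_int n"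
    by (metis int_nat_eq of_int_of_nat_eq)
  then show ?thesis using xn by simp
qed

text \<open>Congruence modulo \<open>\<pi>\<close> in \<open>\<int>[\<omega>]\<close> is divisibility of the difference; the library's \<open>cong\<close>
  would need a Euclidean division on the type.  The value is only meaningful when the norm of
  \<open>\<pi>\<close> is a rational prime congruent to 1 modulo 3 (then \<open>\<pi>\<close> is prime); see
  \<open>cubic_char_unique\<close>.\<close>

definition cubic_char :: "eisenstein \<Rightarrow> eisenstein \<Rightarrow> eisenstein"
  where "cubic_char \<pi> \<alpha> =
    (if \<pi> dvd \<alpha> then 0
     else THE c. c \<in> {1, omega, eis_cnj omega} \<and> \<pi> dvd (\<alpha> ^ ((eis_norm \<pi> - 1) div 3) - c))"

text \<open>When \<open>4p = L\<^sup>2 + 27M\<^sup>2\<close>, the integers \<open>L\<close> and \<open>M\<close> have the same parity, so the division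
  below is exact; see \<open>eis_norm_LM_prime\<close>.\<close>

definition LM_prime :: "int \<Rightarrow> int \<Rightarrow> eisenstein"
  where "LM_prime L M = of_int ((L + 3 * M) div 2) + of_int (3 * M) * omega"

definition F_char :: "nat \<Rightarrow> int \<Rightarrow> int \<Rightarrow> eisenstein"
  where "F_char q L M = cubic_char (LM_prime L M) (of_nat q)"

definition primary :: "eisenstein \<Rightarrow> bool"
  where "primary x \<longleftrightarrow> prime_elem x \<and>
    (\<exists>a b :: int. x = of_int a + of_int b * omega \<and> 3 dvd b)"

lemma eis_norm_LM_prime:
  assumes "4 * int p = L\<^sup>2 + 27 * M\<^sup>2"
  shows "even (L + 3 * M)" and "eis_norm (LM_prime L M) = p"
proof -
  have "even (L\<^sup>2 + 27 * M\<^sup>2)" using assms by (metis dvd_mult2 even_numeral)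
  then show ev: "even (L + 3 * M)" by simp
  define a where "a = (L + 3 * M) div 2"
  have L: "L = 2 * a - 3 * M" using ev by (auto simp: a_def)
  have "4 * int p = 4 * (a\<^sup>2 - a * (3 * M) + (3 * M)\<^sup>2)"
    unfolding assms L by (simp add: power2_eq_square algebra_simps)
  then have p: "a\<^sup>2 - a * (3 * M) + (3 * M)\<^sup>2 = int p" by simp
  have "(of_nat (eis_norm (LM_prime L M)) :: eisenstein) = of_int (int p)"
    unfolding eis_norm_correct LM_prime_def a_def[symmetric] mult_eis_cnj_coords p ..
  then show "eis_norm (LM_prime L M) = p"
    by (metis of_int_eisenstein_inject of_int_of_nat_eq of_nat_eq_iff)
qed

lemma dvd_eis_norm: "x dvd of_nat (eis_norm x)"
  unfolding eis_norm_correct by simp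

lemma eis_norm_mult: "eis_norm (x * y) = eis_norm x * eis_norm y"
proof -
  have "(of_nat (eis_norm (x * y)) :: eisenstein) = of_nat (eis_norm x * eis_norm y)"
    unfolding of_nat_mult eis_norm_correct by transfer (simp add: mult_ac)
  then show ?thesis
    by (metis of_int_eisenstein_inject of_int_of_nat_eq of_nat_eq_iff)
qed

lemma eis_norm_of_int: "int (eis_norm (of_int n)) = n\<^sup>2"
proof -
  have "(of_nat (eis_norm (of_int n)) :: eisenstein) = of_int (n\<^sup>2)"
    using mult_eis_cnj_coords[of n 0] by (simp add: eis_norm_correct)
  then show ?thesis by (metis of_int_eisenstein_inject of_int_of_nat_eq)
qed

lemma eis_norm_dvd: "x dvd y \<Longrightarrow> eis_norm x dvd eis_norm y"
  by (auto simp: eis_norm_mult elim!: dvdE)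

lemma dvd_of_int_iff:
  assumes "prime (eis_norm \<pi>)"
  shows "\<pi> dvd of_int n \<longleftrightarrow> int (eis_norm \<pi>) dvd n"
proof
  assume "\<pi> dvd of_int n"
  then have "int (eis_norm \<pi>) dvd n\<^sup>2"
    by (metis eis_norm_dvd eis_norm_of_int int_dvd_int_iff)
  then show "int (eis_norm \<pi>) dvd n"
    using assms by (metis prime_dvd_power prime_nat_int_transfer)
next
  assume "int (eis_norm \<pi>) dvd n"
  then obtain k where "n = int (eis_norm \<pi>) * k" by blast
  then have "(of_int n :: eisenstein) = of_nat (eis_norm \<pi>) * of_int k" by simp
  then show "\<pi> dvd of_int n" by (simp add: dvd_eis_norm)
qed

lemma dvd_diff_of_int:
  assumes p: "prime (eis_norm \<pi>)"
  obtains n :: int where "\<pi> dvd x - of_int n"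
proof -
  obtain a b where pi: "\<pi> = of_int a + of_int b * omega" by (rule eisenstein_cases)
  define p where "p = int (eis_norm \<pi>)"
  have pp: "prime p" using p by (simp add: p_def)
  have "(of_int p :: eisenstein) = of_int (a\<^sup>2 - a * b + b\<^sup>2)"
    unfolding p_def of_int_of_nat_eq eis_norm_correct pi by (rule mult_eis_cnj_coords)
  then have norm: "p = a\<^sup>2 - a * b + b\<^sup>2" by (simp only: of_int_eisenstein_inject)
  have "\<not> p dvd b"
  proof
    assume b: "p dvd b"
    have "a\<^sup>2 = p + b * (a - b)" using norm by (simp add: power2_eq_square algebra_simps)
    then have "p dvd a\<^sup>2" using b by simp
    then have a: "p dvd a" using pp by (metis prime_dvd_power)
    from a b obtain k l where "a = p * k" "b = p * l" by (auto elim!: dvdE)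
    with norm have "p * 1 = p * (p * (k\<^sup>2 - k * l + l\<^sup>2))"
      by (simp add: power2_eq_square algebra_simps)
    then have "p * (k\<^sup>2 - k * l + l\<^sup>2) = 1" using pp by (metis mult_cancel_left not_prime_0)
    then have "p dvd 1" by (metis dvd_triv_left)
    then show False using pp by (simp add: not_prime_unit)
  qed
  then have "coprime b p" using pp by (metis coprime_commute prime_imp_coprime)
  then obtain c where "[b * c = 1] (mod p)" using cong_solve_coprime_int by blast
  then have "p dvd b * c - 1" by (simp add: cong_iff_dvd_diff)
  then have d: "\<pi> dvd of_int (b * c - 1)" using dvd_of_int_iff[OF p] unfolding p_def by blast
  obtain u v where x: "x = of_int u + of_int v * omega" by (rule eisenstein_cases)
  have "x - of_int (u - v * a * c)
      = of_int v * (of_int c * \<pi> - of_int (b * c - 1) * omega)"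
    unfolding x pi by (simp add: algebra_simps)
  moreover have "\<pi> dvd of_int v * (of_int c * \<pi> - of_int (b * c - 1) * omega)"
    using d by (intro dvd_mult dvd_diff dvd_mult2) auto
  ultimately show ?thesis using that by metis
qed

lemma prime_elem_of_prime_norm:
  assumes p: "prime (eis_norm \<pi>)"
  shows "prime_elem \<pi>"
proof (rule prime_elemI)
  show "\<pi> \<noteq> 0"
    using p eis_norm_of_int[of 0] by auto
  show "\<not> \<pi> dvd 1"
    using dvd_of_int_iff[OF p, of 1] p by (simp add: prime_nat_iff)
  fix x y
  assume xy: "\<pi> dvd x * y"
  obtain m n where m: "\<pi> dvd x - of_int m" and n: "\<pi> dvd y - of_int n"
    using dvd_diff_of_int[OF p] by metis
  have "of_int (m * n) = x * y - (x - of_int m) * y - of_int m * (y - of_int n)"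
    by (simp add: algebra_simps)
  then have "\<pi> dvd of_int (m * n)" using xy m n by simp
  then have "int (eis_norm \<pi>) dvd m * n" using dvd_of_int_iff[OF p] by blast
  then have "int (eis_norm \<pi>) dvd m \<or> int (eis_norm \<pi>) dvd n"
    using p by (simp add: prime_dvd_mult_iff)
  then have "\<pi> dvd of_int m \<or> \<pi> dvd of_int n" using dvd_of_int_iff[OF p] by blast
  then show "\<pi> dvd x \<or> \<pi> dvd y"
    using m n by (metis diff_add_cancel dvd_add)
qed

lemma primary_LM_prime:
  assumes "prime p" and "4 * int p = L\<^sup>2 + 27 * M\<^sup>2"
  shows "primary (LM_prime L M)"
proof -
  have "prime_elem (LM_prime L M)"
    using assms by (intro prime_elem_of_prime_norm) (simp add: eis_norm_LM_prime(2))
  then show ?thesis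
    unfolding primary_def LM_prime_def by (metis dvd_triv_left)
qed

lemma cubic_char_unique:
  assumes p: "prime (eis_norm \<pi>)" and p3: "[eis_norm \<pi> = 1] (mod 3)" and "\<not> \<pi> dvd \<alpha>"
  shows "\<exists>!c. c \<in> {1, omega, eis_cnj omega} \<and> \<pi> dvd (\<alpha> ^ ((eis_norm \<pi> - 1) div 3) - c)"
proof -
  define p where "p = eis_norm \<pi>"
  define x where "x = \<alpha> ^ ((p - 1) div 3)"
  have pe: "prime_elem \<pi>" using p by (rule prime_elem_of_prime_norm)
  have "p > 0" using p by (simp add: p_def prime_gt_0_nat)
  have "3 dvd p - 1"
    using p3 \<open>p > 0\<close> by (metis One_nat_def Suc_leI cong_to_1_nat p_def)
  then have x3: "x ^ 3 = \<alpha> ^ (p - 1)"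
    unfolding x_def power_mult[symmetric] by simp
  obtain n where n: "\<pi> dvd \<alpha> - of_int n" using dvd_diff_of_int[OF p] by blast
  have nn: "\<not> int p dvd n"
    using \<open>\<not> \<pi> dvd \<alpha>\<close> n dvd_of_int_iff[OF p, of n]
    by (metis diff_add_cancel dvd_add p_def)
  have "[n ^ (p - 1) = 1] (mod int p)"
  proof -
    define m where "m = nat (n mod int p)"
    have m: "int m = n mod int p" using \<open>p > 0\<close> by (simp add: m_def)
    have "\<not> p dvd m" using nn m
      by (metis dvd_mod_iff dvd_refl int_dvd_int_iff)
    then have "[m ^ (p - 1) = 1] (mod p)"
      using p by (intro fermat_theorem) (simp_all add: p_def)
    then have "[int m ^ (p - 1) = 1] (mod int p)"
      by (metis cong_int_iff of_nat_1 of_nat_power)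
    moreover have "[n = int m] (mod int p)" by (simp add: m cong_def)
    ultimately show ?thesis by (meson cong_pow cong_trans)
  qed
  then have "\<pi> dvd of_int (n ^ (p - 1) - 1)"
    using dvd_of_int_iff[OF p] unfolding p_def cong_iff_dvd_diff by blast
  moreover have "\<alpha> - of_int n dvd \<alpha> ^ (p - 1) - of_int n ^ (p - 1)"
    by (metis dvd_triv_left power_diff_sumr2)
  then have "\<pi> dvd \<alpha> ^ (p - 1) - of_int n ^ (p - 1)" using n dvd_trans by blast
  ultimately have "\<pi> dvd (\<alpha> ^ (p - 1) - of_int n ^ (p - 1)) + of_int (n ^ (p - 1) - 1)"
    by (rule_tac dvd_add)
  then have "\<pi> dvd x ^ 3 - 1" by (simp add: x3)
  moreover have "x ^ 3 - 1 = (x - 1) * ((x - omega) * (x - eis_cnj omega))"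
  proof -
    have "(x - omega) * (x - eis_cnj omega) = x * x + x + (- omega - omega * omega)"
      unfolding eis_cnj_omega by (simp add: algebra_simps)
    then show ?thesis
      unfolding omega_square by (simp add: power3_eq_cube algebra_simps)
  qed
  ultimately have ex: "\<exists>c \<in> {1, omega, eis_cnj omega}. \<pi> dvd x - c"
    using pe by (auto simp: prime_elem_dvd_mult_iff)
  have not3: "\<not> \<pi> dvd of_int 3"
  proof
    assume "\<pi> dvd of_int 3"
    then have "int p dvd 3" using dvd_of_int_iff[OF p] unfolding p_def by blast
    then have "p dvd 3" by presburger
    then have "p = 3" using p by (simp add: p_def primes_dvd_imp_eq)
    then show False using p3 by (simp add: p_def cong_def)
  qed
  have w: "omega + omega * omega = -1" by (simp add: omega_square)
  have "(1 - omega) * (1 - eis_cnj omega) = 2 - (omega + omega * omega)"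
    unfolding eis_cnj_omega by (simp add: algebra_simps)
  then have three: "of_int 3 = (1 - omega) * (1 - eis_cnj omega)"
    unfolding w by simp
  have "- (omega - eis_cnj omega) * (omega - eis_cnj omega) = - 1 - 4 * (omega + omega * omega)"
    unfolding eis_cnj_omega by (simp add: algebra_simps)
  then have three': "of_int 3 = - (omega - eis_cnj omega) * (omega - eis_cnj omega)"
    unfolding w by simp
  have a: "\<not> \<pi> dvd 1 - omega" using not3 three by (metis dvd_mult2)
  have b: "\<not> \<pi> dvd 1 - eis_cnj omega" using not3 three by (metis dvd_mult)
  have c: "\<not> \<pi> dvd omega - eis_cnj omega" using not3 three' by (metis dvd_mult)
  have uniq: "d = e" if "d \<in> {1, omega, eis_cnj omega}" "e \<in> {1, omega, eis_cnj omega}"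
    "\<pi> dvd x - d" "\<pi> dvd x - e" for d e
  proof -
    have "\<pi> dvd (x - d) - (x - e)" using that(3,4) by (rule dvd_diff)
    then have *: "\<pi> dvd e - d" by simp
    then have **: "\<pi> dvd d - e" by (metis dvd_minus_iff minus_diff_eq)
    show ?thesis using * ** a b c that(1,2) by auto
  qed
  show ?thesis using ex uniq unfolding x_def p_def by blast
qed

end

theory Submission
  imports Defs
begin

text \<open>
  Let \<open>n = (q\<^sup>2 - 1) / 3\<close>.  Cubing a Gauss sum gives \<open>G ^ 3 = p J\<close> with the Jacobi sum
  \<open>J = \<plusminus>\<pi>\<close>, while Frobenius modulo \<open>q\<close> evaluates \<open>G ^ q\<close>; comparing the two yields
  \<open>\<chi>(q) \<pi> ^ n \<equiv> cnj \<pi> ^ n\<close> modulo \<open>q\<close>, whatever the residue of \<open>q\<close> modulo 3.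

  Put \<open>\<theta> = 1 + 2 \<omega>\<close>, a square root of \<open>-3\<close>, so that \<open>2 \<pi> = L + 3 M \<theta>\<close>.  The two congruences
  in \<open>t\<close> say that \<open>z = (t + \<theta>) ^ 3 \<alpha>\<close> agrees with its conjugate modulo \<open>q\<close>, where \<open>\<alpha>\<close> is \<open>cnj \<pi> \<omega>\<close>
  for \<open>q \<equiv> \<plusminus>2\<close> and \<open>\<pi> \<omega>\<close> for \<open>q \<equiv> \<plusminus>4\<close> modulo 9.  Units modulo \<open>q\<close> have exponent \<open>3 n\<close>, so
  raising to the \<open>n\<close>-th power shows that such a \<open>t\<close> forces \<open>\<alpha> ^ n \<equiv> cnj \<alpha> ^ n\<close>.  Conversely, 3 does not
  divide \<open>n\<close>, so that \<open>\<alpha> ^ n \<equiv> cnj \<alpha> ^ n\<close> makes \<open>cnj \<alpha> / \<alpha>\<close> an explicit cube, which gives \<open>t\<close>.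
  Inserting the formula for \<open>\<chi>(q)\<close>, the condition \<open>\<alpha> ^ n \<equiv> cnj \<alpha> ^ n\<close> becomes \<open>\<chi>(q) = \<omega>\<close>.
\<close>

section \<open>Congruences in commutative rings\<close>

text \<open>Stated for every commutative ring because it is used both in
  \<open>\<int>[\<omega>]\<close> and in polynomial rings over it.\<close>

definition ring_cong :: "'a::comm_ring_1 \<Rightarrow> 'a \<Rightarrow> 'a \<Rightarrow> bool"
  where "ring_cong m x y \<longleftrightarrow> m dvd x - y"

lemma ring_cong_refl [simp]: "ring_cong m x x"
  by (simp add: ring_cong_def)

lemma ring_cong_sym: "ring_cong m x y \<Longrightarrow> ring_cong m y x"
  unfolding ring_cong_def by (metis dvd_minus_iff minus_diff_eq)

lemma ring_cong_trans [trans]: "ring_cong m x y \<Longrightarrow> ring_cong m y z \<Longrightarrow> ring_cong m x z"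
  unfolding ring_cong_def by (metis diff_add_cancel add_diff_eq dvd_add)

lemma ring_cong_add: "ring_cong m x y \<Longrightarrow> ring_cong m x' y' \<Longrightarrow> ring_cong m (x + x') (y + y')"
  unfolding ring_cong_def by (metis add_diff_add dvd_add)

lemma ring_cong_mult: "ring_cong m x y \<Longrightarrow> ring_cong m x' y' \<Longrightarrow> ring_cong m (x * x') (y * y')"
proof -
  assume "ring_cong m x y" "ring_cong m x' y'"
  moreover have "x * x' - y * y' = (x - y) * x' + y * (x' - y')"
    by (simp add: algebra_simps)
  ultimately show ?thesis
    unfolding ring_cong_def by (metis dvd_add dvd_mult dvd_mult2)
qed

lemma ring_cong_mult_left: "ring_cong m x y \<Longrightarrow> ring_cong m (c * x) (c * y)"
  by (rule ring_cong_mult[OF ring_cong_refl])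

lemma ring_cong_power: "ring_cong m x y \<Longrightarrow> ring_cong m (x ^ n) (y ^ n)"
  by (induction n) (auto intro: ring_cong_mult)

lemma ring_cong_sum: "(\<And>i. i \<in> A \<Longrightarrow> ring_cong m (f i) (g i)) \<Longrightarrow> ring_cong m (sum f A) (sum g A)"
  by (induction A rule: infinite_finite_induct) (auto intro: ring_cong_add)

lemma ring_cong_dvd: "ring_cong m x y \<Longrightarrow> m dvd y \<Longrightarrow> m dvd x"
  unfolding ring_cong_def by (drule (1) dvd_add) simp

text \<open>\<open>v\<close> inverts \<open>u\<close> modulo \<open>m\<close>. Cancellation is
  phrased through inverses because residues modulo a split prime include zero divisors.\<close>

lemma ring_cong_cancel:
  assumes "ring_cong m (u * v) 1" and "ring_cong m (u * x) (u * y)"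
  shows "ring_cong m x y"
proof -
  have "ring_cong m (1 * x) (u * v * x)"
    using assms(1) by (intro ring_cong_mult ring_cong_sym[OF assms(1)]) simp
  also have "u * v * x = v * (u * x)" by (simp add: mult_ac)
  also have "ring_cong m \<dots> (v * (u * y))" by (intro ring_cong_mult_left assms)
  also have "v * (u * y) = u * v * y" by (simp add: mult_ac)
  also have "ring_cong m \<dots> (1 * y)" by (intro ring_cong_mult assms) simp
  finally show ?thesis by simp
qed

text \<open>Binomial theorem: \<open>q\<close> divides all the inner coefficients.\<close>

lemma frobenius_add:
  fixes x y :: "'a::comm_ring_1"
  assumes q: "prime q"
  shows "ring_cong (of_nat q) ((x + y) ^ q) (x ^ q + y ^ q)"
proof -
  have "q > 0" using q by (rule prime_gt_0_nat)
  let ?f = "\<lambda>k. of_nat (q choose k) * x ^ k * y ^ (q - k)"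
  have "(x + y) ^ q = (\<Sum>k\<le>q. ?f k)" by (rule binomial_ring)
  also have "{..q} = insert 0 (insert q {0<..<q})" using \<open>q > 0\<close> by auto
  also have "sum ?f \<dots> = x ^ q + y ^ q + sum ?f {0<..<q}"
    using \<open>q > 0\<close> by (simp add: algebra_simps)
  finally have "(x + y) ^ q - (x ^ q + y ^ q) = sum ?f {0<..<q}" by simp
  moreover have "of_nat q dvd sum ?f {0<..<q}"
  proof (intro dvd_sum dvd_mult2)
    fix k assume "k \<in> {0<..<q}"
    then have "q dvd (q choose k)" using q by (intro dvd_choose_prime) auto
    then show "(of_nat q :: 'a) dvd of_nat (q choose k)" by (auto elim!: dvdE)
  qed
  ultimately show ?thesis by (simp add: ring_cong_def)
qed

lemma frobenius_sum:
  fixes f :: "'b \<Rightarrow> 'a::comm_ring_1"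
  assumes q: "prime q"
  shows "ring_cong (of_nat q) ((\<Sum>i\<in>A. f i) ^ q) (\<Sum>i\<in>A. f i ^ q)"
proof (induction A rule: infinite_finite_induct)
  case (insert a A)
  have "ring_cong (of_nat q) ((f a + sum f A) ^ q) (f a ^ q + sum f A ^ q)"
    by (rule frobenius_add[OF q])
  also have "ring_cong (of_nat q) \<dots> (f a ^ q + (\<Sum>i\<in>A. f i ^ q))"
    by (intro ring_cong_add insert.IH) simp
  finally show ?case using insert.hyps by simp
qed (use prime_gt_0_nat[OF q] in \<open>auto simp: zero_power\<close>)

lemma ring_cong_of_int: "[a = b] (mod m) \<Longrightarrow> ring_cong (of_int m) (of_int a) (of_int b)"
  unfolding ring_cong_def cong_iff_dvd_diff by (auto simp flip: of_int_diff elim!: dvdE)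

lemma fermat_int:
  fixes a :: int
  assumes q: "prime q"
  shows "[a ^ q = a] (mod int q)"
proof (cases "int q dvd a")
  case True
  then have "int q dvd a ^ q"
    using prime_gt_0_nat[OF q] by (simp add: dvd_power_iff_le dvd_trans dvd_power)
  then show ?thesis using True by (simp add: cong_iff_dvd_diff)
next
  case False
  define m where "m = nat (a mod int q)"
  have m: "int m = a mod int q" using prime_gt_0_nat[OF q] by (simp add: m_def)
  have "\<not> q dvd m" using False m by (metis dvd_mod_iff dvd_refl int_dvd_int_iff)
  then have "[m ^ (q - 1) = 1] (mod q)" by (rule fermat_theorem[OF q])
  then have "[int m ^ (q - 1) = 1] (mod int q)"
    by (metis cong_int_iff of_nat_1 of_nat_power)
  moreover have am: "[a = int m] (mod int q)" by (simp add: m cong_def)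
  ultimately have "[a ^ (q - 1) = 1] (mod int q)" by (meson cong_pow cong_trans)
  then have "[a ^ (q - 1) * a = 1 * a] (mod int q)" by (rule cong_scalar_right)
  then show ?thesis using prime_gt_0_nat[OF q] by (simp add: power_eq_if mult.commute)
qed

lemma int_prime_inverse:
  assumes q: "prime q" and "\<not> int q dvd a"
  obtains c where "[a * c = 1] (mod int q)"
proof -
  have "coprime a (int q)"
    using assms by (metis coprime_commute prime_imp_coprime prime_nat_int_transfer)
  then show ?thesis using that cong_solve_coprime_int by blast
qed

section \<open>Eisenstein integers\<close>

lemma eis_complex_coords: "eis_complex (of_int a + of_int b * omega) = of_int a + of_int b * omega_c"
  by (simp add: plus_eisenstein.rep_eq times_eisenstein.rep_eq omega.rep_eq)

lemma eis_coords_eq_0: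
  "(of_int a + of_int b * omega :: eisenstein) = 0 \<longleftrightarrow> a = 0 \<and> b = 0"
proof
  assume "(of_int a + of_int b * omega :: eisenstein) = 0"
  then have z: "of_int a + of_int b * omega_c = 0"
    by (metis eis_complex_coords zero_eisenstein.rep_eq)
  then have "Im (of_int a + of_int b * omega_c) = 0" by simp
  then have "b = 0" by (simp add: omega_c_explicit)
  with z show "a = 0 \<and> b = 0" by simp
qed simp

lemma eis_coords_eq_iff:
  "(of_int a + of_int b * omega :: eisenstein) = of_int c + of_int d * omega \<longleftrightarrow> a = c \<and> b = d"
  using eis_coords_eq_0[of "a - c" "b - d"] by (auto simp: algebra_simps)

text \<open>Holds because 1 and \<open>omega\<close> form a \<open>\<int>\<close>-basis.\<close>

lemma of_int_dvd_eis_iff: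
  "of_int m dvd (of_int a + of_int b * omega :: eisenstein) \<longleftrightarrow> m dvd a \<and> m dvd b"
proof
  assume "of_int m dvd (of_int a + of_int b * omega :: eisenstein)"
  then obtain z where z: "of_int a + of_int b * omega = of_int m * z" by blast
  obtain c d where "z = of_int c + of_int d * omega" by (rule eisenstein_cases)
  with z have "of_int a + of_int b * omega = of_int (m * c) + of_int (m * d) * omega"
    by (simp add: algebra_simps)
  then show "m dvd a \<and> m dvd b" unfolding eis_coords_eq_iff by simp
next
  assume "m dvd a \<and> m dvd b"
  then show "of_int m dvd (of_int a + of_int b * omega :: eisenstein)"
    by (auto elim!: dvdE simp: algebra_simps simp flip: distrib_left)
qed

lemma of_int_dvd_of_int_eis_iff: "(of_int m :: eisenstein) dvd of_int a \<longleftrightarrow> m dvd a"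
  using of_int_dvd_eis_iff[of m a 0] by simp

lemma omega_cube: "omega ^ 3 = 1"
proof -
  have "omega ^ 3 = omega * (omega * omega)" by (simp add: power3_eq_cube mult.assoc)
  also have "\<dots> = 1" unfolding omega_square by (simp add: right_diff_distrib omega_square)
  finally show ?thesis .
qed

lemma omega_power_mod: "omega ^ n = omega ^ (n mod 3)"
proof -
  have "omega ^ n = omega ^ (3 * (n div 3) + n mod 3)" by simp
  then show ?thesis unfolding power_add power_mult omega_cube by simp
qed

lemma eis_cnj_omega_square: "eis_cnj omega = omega ^ 2"
  by (simp add: eis_cnj_omega power2_eq_square omega_square)

lemma eis_cube_roots_of_unity: "x ^ 3 = 1 \<longleftrightarrow> x \<in> {1, omega, eis_cnj omega}"
proof -
  have "(x - omega) * (x - eis_cnj omega) = x * x + x + (- omega - omega * omega)"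
    unfolding eis_cnj_omega by (simp add: algebra_simps)
  then have "x ^ 3 - 1 = (x - 1) * ((x - omega) * (x - eis_cnj omega))"
    unfolding omega_square by (simp add: power3_eq_cube algebra_simps)
  then have "x ^ 3 - 1 = 0 \<longleftrightarrow> x - 1 = 0 \<or> x - omega = 0 \<or> x - eis_cnj omega = 0"
    by simp
  then show ?thesis by simp
qed

section \<open>Conjugation, norm, and residues modulo a rational prime\<close>

lemma eis_cnj_add [simp]: "eis_cnj (x + y) = eis_cnj x + eis_cnj y"
  by transfer simp

lemma eis_cnj_mult [simp]: "eis_cnj (x * y) = eis_cnj x * eis_cnj y"
  by transfer simp

lemma eis_cnj_diff [simp]: "eis_cnj (x - y) = eis_cnj x - eis_cnj y"
  by transfer simp

lemma eis_cnj_0 [simp]: "eis_cnj 0 = 0"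
  by transfer simp

lemma eis_cnj_1 [simp]: "eis_cnj 1 = 1"
  by transfer simp

lemma eis_cnj_power [simp]: "eis_cnj (x ^ n) = eis_cnj x ^ n"
  by (induction n) simp_all

lemma eis_cnj_cnj [simp]: "eis_cnj (eis_cnj x) = x"
  by transfer simp

lemma eis_cnj_of_int [simp]: "eis_cnj (of_int n) = of_int n"
  using eis_cnj_coords[of n 0] by simp

lemma eis_cnj_of_nat [simp]: "eis_cnj (of_nat n) = of_nat n"
  using eis_cnj_of_int[of "int n"] by simp

lemma eis_cnj_numeral [simp]: "eis_cnj (numeral k) = numeral k"
  using eis_cnj_of_int[of "numeral k"] by simp

lemma eis_cnj_sum: "eis_cnj (sum f A) = (\<Sum>i\<in>A. eis_cnj (f i))"
  by (induction A rule: infinite_finite_induct) simp_all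

lemma eis_cnj_cube_root: "x ^ 3 = 1 \<Longrightarrow> eis_cnj x = x ^ 2"
  unfolding eis_cube_roots_of_unity
  by (auto simp: eis_cnj_omega_square omega_power_mod[of 4] simp flip: power_mult)

lemma of_nat_eisenstein_inject: "(of_nat m :: eisenstein) = of_nat n \<longleftrightarrow> m = n"
  using of_int_eisenstein_inject[of "int m" "int n"] by simp

lemma eis_norm_cnj: "eis_norm (eis_cnj x) = eis_norm x"
  using eis_norm_correct[of x] eis_norm_correct[of "eis_cnj x"]
  by (simp add: mult.commute flip: of_nat_eisenstein_inject)

lemma eis_norm_omega: "eis_norm omega = 1"
  using eis_norm_correct[of omega] omega_cube
  by (simp add: eis_cnj_omega_square power2_eq_square power3_eq_cube mult.assoc
      flip: of_nat_eisenstein_inject)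

text \<open>Conjugation fixes the modulus because it is rational.\<close>

lemma ring_cong_cnj:
  assumes "ring_cong (of_int m) x y"
  shows "ring_cong (of_int m) (eis_cnj x) (eis_cnj y)"
proof -
  from assms obtain z where "x - y = of_int m * z" unfolding ring_cong_def by blast
  then have "eis_cnj x - eis_cnj y = of_int m * eis_cnj z"
    by (metis eis_cnj_diff eis_cnj_mult eis_cnj_of_int)
  then show ?thesis by (simp add: ring_cong_def)
qed

text \<open>The inverse is the conjugate times an inverse of the norm modulo
  \<open>q\<close>.\<close>

lemma eis_unit_mod:
  assumes q: "prime q" and "\<not> q dvd eis_norm x"
  obtains y where "ring_cong (of_nat q) (x * y) 1"
proof -
  have "\<not> int q dvd int (eis_norm x)" using assms by simp
  then obtain c where "[int (eis_norm x) * c = 1] (mod int q)"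
    by (rule int_prime_inverse[OF q])
  from ring_cong_of_int[OF this, where 'a = eisenstein]
  have "ring_cong (of_nat q) (x * (eis_cnj x * of_int c)) 1"
    by (simp add: eis_norm_correct mult.assoc)
  then show ?thesis by (rule that)
qed

text \<open>Fermat fixes the rational coordinates, and \<open>omega ^ q\<close> depends only on
  \<open>q\<close> modulo 3. Frobenius is thus the identity for split \<open>q\<close> and
  conjugation for inert \<open>q\<close>.\<close>

lemma eis_frobenius:
  fixes x :: eisenstein
  assumes q: "prime q" and q3: "\<not> 3 dvd q"
  shows "ring_cong (of_nat q) (x ^ q) (if q mod 3 = 1 then x else eis_cnj x)"
proof -
  obtain a b where x: "x = of_int a + of_int b * omega" by (rule eisenstein_cases)
  have f: "ring_cong (of_nat q) ((of_int c :: eisenstein) ^ q) (of_int c)" for c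
    using ring_cong_of_int[OF fermat_int[OF q, of c], where 'a = eisenstein] by simp
  have "ring_cong (of_nat q) (x ^ q) (of_int a ^ q + of_int b ^ q * omega ^ q)"
    using frobenius_add[OF q, of "of_int a" "of_int b * omega"] by (simp add: x power_mult_distrib)
  also have "ring_cong (of_nat q) \<dots> (of_int a + of_int b * omega ^ q)"
    by (intro ring_cong_add ring_cong_mult f) simp
  also have "of_int a + of_int b * omega ^ q = (if q mod 3 = 1 then x else eis_cnj x)"
  proof (cases "q mod 3 = 1")
    case True
    then show ?thesis by (subst omega_power_mod) (simp add: x)
  next
    case False
    then have "q mod 3 = 2" using q3 by presburger
    then show ?thesis by (subst omega_power_mod) (simp add: x eis_cnj_omega_square)
  qed
  finally show ?thesis .
qed

lemma eis_power_square:
  fixes x :: eisenstein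
  assumes q: "prime q" and q3: "\<not> 3 dvd q"
  shows "ring_cong (of_nat q) (x ^ (q\<^sup>2)) x"
proof -
  have "ring_cong (of_nat q) ((x ^ q) ^ q) ((if q mod 3 = 1 then x else eis_cnj x) ^ q)"
    by (intro ring_cong_power eis_frobenius q q3)
  also have "ring_cong (of_nat q) \<dots> x"
    using eis_frobenius[OF q q3, of x] eis_frobenius[OF q q3, of "eis_cnj x"] by auto
  finally show ?thesis by (simp add: power2_eq_square power_mult)
qed

lemma eis_power_square_minus_1:
  fixes x :: eisenstein
  assumes q: "prime q" and q3: "\<not> 3 dvd q" and "\<not> q dvd eis_norm x"
  shows "ring_cong (of_nat q) (x ^ (q\<^sup>2 - 1)) 1"
proof -
  obtain y where y: "ring_cong (of_nat q) (x * y) 1" using eis_unit_mod[OF q assms(3)] .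
  have "x * x ^ (q\<^sup>2 - 1) = x ^ (q\<^sup>2)"
    using prime_gt_0_nat[OF q] by (simp add: power_eq_if)
  then have "ring_cong (of_nat q) (x * x ^ (q\<^sup>2 - 1)) (x * 1)"
    using eis_power_square[OF q q3, of x] by simp
  then show ?thesis by (rule ring_cong_cancel[OF y])
qed

text \<open>The residue ring has no nilpotents: \<open>x\<close> is congruent to
  \<open>x ^ (q\<^sup>2)\<close>, a multiple of \<open>x ^ m\<close>.\<close>

lemma eis_cong_0_of_power:
  fixes x :: eisenstein
  assumes q: "prime q" and q3: "\<not> 3 dvd q" and "m \<le> q\<^sup>2" and "ring_cong (of_nat q) (x ^ m) 0"
  shows "ring_cong (of_nat q) x 0"
proof -
  have "ring_cong (of_nat q) x (x ^ (q\<^sup>2))" by (rule ring_cong_sym[OF eis_power_square[OF q q3]])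
  also have "x ^ (q\<^sup>2) = x ^ m * x ^ (q\<^sup>2 - m)" using assms(3) by (simp flip: power_add)
  also have "ring_cong (of_nat q) \<dots> (0 * x ^ (q\<^sup>2 - m))" by (intro ring_cong_mult assms) simp
  finally show ?thesis by simp
qed

text \<open>A difference of two distinct cube roots of unity has a coordinate 1 or -1, so no
  rational integer except 1 and -1 divides it.\<close>

lemma eis_cube_root_unique_mod:
  fixes x y :: eisenstein
  assumes "x ^ 3 = 1" "y ^ 3 = 1" "ring_cong (of_int m) x y" "\<not> m dvd 3"
  shows "x = y"
proof -
  have m: "\<not> m dvd 1" using assms(4) by (meson dvd_trans one_dvd)
  have *: "\<not> ring_cong (of_int m) 1 omega" "\<not> ring_cong (of_int m) 1 (eis_cnj omega)"
      "\<not> ring_cong (of_int m) omega (eis_cnj omega)"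
    using of_int_dvd_eis_iff[of m 1 "-1"] of_int_dvd_eis_iff[of m 2 1] of_int_dvd_eis_iff[of m 1 2] m
    by (auto simp: ring_cong_def eis_cnj_omega algebra_simps)
  then show ?thesis
    using assms(1-3) unfolding eis_cube_roots_of_unity by (auto dest: ring_cong_sym)
qed

section \<open>Convolution and power sums\<close>

text \<open>Polynomials act on functions on the integers, the variable shifting the argument by 1.  On
  \<open>p\<close>-periodic functions this is the action of the group ring of \<open>\<int>/p\<close>; it lets Frobenius be
  applied to Gauss sums without constructing that ring.\<close>

definition shift_act :: "'a::comm_ring_1 poly \<Rightarrow> (int \<Rightarrow> 'a) \<Rightarrow> int \<Rightarrow> 'a"
  where "shift_act f h u = (\<Sum>j\<le>Polynomial.degree f. Polynomial.coeff f j * h (u - int j))"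

lemma shift_act_bound:
  "Polynomial.degree f \<le> n \<Longrightarrow> shift_act f h u = (\<Sum>j\<le>n. Polynomial.coeff f j * h (u - int j))"
  unfolding shift_act_def by (rule sum.mono_neutral_left) (auto simp: coeff_eq_0)

lemma shift_act_0 [simp]: "shift_act 0 h u = 0"
  by (simp add: shift_act_def)

lemma shift_act_add: "shift_act (f + g) h u = shift_act f h u + shift_act g h u"
  by (simp add: shift_act_bound[of _ "max (Polynomial.degree f) (Polynomial.degree g)"] Polynomial.degree_add_le
      distrib_right sum.distrib)

lemma shift_act_sum: "shift_act (\<Sum>i\<in>A. f i) h u = (\<Sum>i\<in>A. shift_act (f i) h u)"
  by (induction A rule: infinite_finite_induct) (simp_all add: shift_act_add)

lemma shift_act_smult: "shift_act (Polynomial.smult c f) h u = c * shift_act f h u"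
  by (simp add: shift_act_bound[of _ "Polynomial.degree f"] degree_smult_le sum_distrib_left mult.assoc)

lemma shift_act_pCons: "shift_act (pCons a f) h u = a * h u + shift_act f h (u - 1)"
  by (subst shift_act_bound[of _ "Suc (Polynomial.degree f)"])
    (simp_all add: degree_pCons_le sum.atMost_Suc_shift shift_act_def algebra_simps
      del: sum.atMost_Suc)

text \<open>This is a module action: multiplying polynomials composes the operators, so powers
  become iterates.\<close>

lemma shift_act_mult: "shift_act (f * g) h = shift_act f (shift_act g h)"
proof
  show "shift_act (f * g) h u = shift_act f (shift_act g h) u" for u
    by (induction f arbitrary: u)
      (simp_all add: shift_act_add shift_act_smult shift_act_pCons)
qed

lemma shift_act_monom: "shift_act (Polynomial.monom c k) h u = c * h (u - int k)"
  by (induction k arbitrary: u) (simp_all add: monom_0 monom_Suc shift_act_pCons algebra_simps)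

lemma shift_act_power: "shift_act (f ^ n) h = (shift_act f ^^ n) h"
proof (induction n)
  case 0
  show ?case by (rule ext) (simp add: shift_act_def)
qed (simp add: shift_act_mult)

text \<open>Convolution on \<open>\<int>/p\<close>. The argument of \<open>h\<close> is not reduced,
  so \<open>h\<close> is meant to be \<open>p\<close>-periodic.\<close>

definition conv :: "nat \<Rightarrow> (int \<Rightarrow> 'a::comm_ring_1) \<Rightarrow> (int \<Rightarrow> 'a) \<Rightarrow> int \<Rightarrow> 'a"
  where "conv p f h u = (\<Sum>t\<in>{0..<int p}. f t * h (u - t))"

text \<open>The polynomial is a formal Gauss sum, with the variable in place of a root of
  unity.\<close>

lemma conv_eq_shift_act:
  "conv p f h = shift_act (\<Sum>t<p. Polynomial.monom (f (int t)) t) h"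
proof
  show "conv p f h u = shift_act (\<Sum>t<p. Polynomial.monom (f (int t)) t) h u" for u
    unfolding conv_def shift_act_sum shift_act_monom
    by (rule sum.reindex_bij_witness[of _ int nat]) auto
qed

text \<open>In the polynomial ring, Frobenius raises coefficients to the power \<open>q\<close> and
  multiplies exponents by \<open>q\<close>. The error is \<open>q\<close> times a polynomial and
  acts as a multiple of \<open>q\<close>.\<close>

lemma conv_frobenius:
  fixes f h :: "int \<Rightarrow> 'a::comm_ring_1"
  assumes q: "prime q"
  shows "ring_cong (of_nat q) ((conv p f ^^ q) h u)
           (\<Sum>t\<in>{0..<int p}. f t ^ q * h (u - int q * t))"
proof -
  let ?g = "\<lambda>t. Polynomial.monom (f (int t)) t"
  obtain B where B: "(\<Sum>t<p. ?g t) ^ q - (\<Sum>t<p. ?g t ^ q) = of_nat q * B"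
    using frobenius_sum[OF q, of ?g "{..<p}"] unfolding ring_cong_def by blast
  then have "(\<Sum>t<p. ?g t) ^ q = (\<Sum>t<p. ?g t ^ q) + Polynomial.smult (of_nat q) B"
    by (simp add: algebra_simps of_nat_poly)
  then have "(conv p f ^^ q) h u
      = (\<Sum>t<p. f (int t) ^ q * h (u - int q * int t)) + of_nat q * shift_act B h u"
    unfolding conv_eq_shift_act shift_act_power[symmetric]
    by (simp add: shift_act_add shift_act_smult shift_act_sum shift_act_monom monom_power mult.commute)
  also have "(\<Sum>t<p. f (int t) ^ q * h (u - int q * int t))
      = (\<Sum>t\<in>{0..<int p}. f t ^ q * h (u - int q * t))"
    by (rule sum.reindex_bij_witness[of _ nat int]) auto
  finally show ?thesis by (simp add: ring_cong_def)
qed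

lemma conv_commute: "conv p f (conv p g h) = conv p g (conv p f h)"
proof
  fix u
  have "conv p f (conv p g h) u
      = (\<Sum>t\<in>{0..<int p}. \<Sum>s\<in>{0..<int p}. f t * (g s * h (u - t - s)))"
    by (simp add: conv_def sum_distrib_left)
  also have "\<dots> = (\<Sum>s\<in>{0..<int p}. \<Sum>t\<in>{0..<int p}. f t * (g s * h (u - t - s)))"
    by (rule sum.swap)
  also have "\<dots> = conv p g (conv p f h) u"
    unfolding conv_def sum_distrib_left
    by (intro sum.cong refl) (simp add: algebra_simps)
  finally show "conv p f (conv p g h) u = conv p g (conv p f h) u" .
qed

lemma conv_cmult: "conv p f (\<lambda>u. c * h u) = (\<lambda>u. c * conv p f h u)"
  by (rule ext) (simp add: conv_def sum_distrib_left algebra_simps)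

text \<open>\<open>\<phi>\<close> followed by reduction modulo \<open>p\<close> is an injection of
  the representatives into themselves, hence a permutation.\<close>

lemma sum_periodic_bij:
  fixes F :: "int \<Rightarrow> 'a::comm_monoid_add"
  assumes p: "p > 0" and per: "\<And>t. F (t mod p) = F t"
    and inj: "\<And>s t. [\<phi> s = \<phi> t] (mod p) \<Longrightarrow> [s = t] (mod p)"
  shows "(\<Sum>t\<in>{0..<p}. F (\<phi> t)) = (\<Sum>t\<in>{0..<p}. F t)"
proof -
  let ?m = "\<lambda>t. \<phi> t mod p"
  have "inj_on ?m {0..<p}"
  proof (rule inj_onI)
    fix s t assume st: "s \<in> {0..<p}" "t \<in> {0..<p}" "?m s = ?m t"
    then have "[\<phi> s = \<phi> t] (mod p)" by (simp add: cong_def)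
    then have "[s = t] (mod p)" by (rule inj)
    then show "s = t" using st cong_less_imp_eq_int[of s p t] by simp
  qed
  moreover have "?m ` {0..<p} \<subseteq> {0..<p}" using p by auto
  ultimately have "?m ` {0..<p} = {0..<p}" by (intro endo_inj_surj) auto
  then have "(\<Sum>t\<in>{0..<p}. F t) = (\<Sum>t\<in>{0..<p}. F (?m t))"
    using sum.reindex[OF \<open>inj_on ?m {0..<p}\<close>, of F] by (simp add: o_def)
  then show ?thesis by (simp add: per)
qed

lemma sum_periodic_shift:
  fixes F :: "int \<Rightarrow> 'a::comm_monoid_add"
  assumes "p > 0" and "\<And>t. F (t mod p) = F t"
  shows "(\<Sum>t\<in>{0..<p}. F (t - c)) = (\<Sum>t\<in>{0..<p}. F t)"
  using assms by (rule sum_periodic_bij) (simp add: cong_iff_dvd_diff)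

lemma sum_periodic_scale:
  fixes F :: "int \<Rightarrow> 'a::comm_monoid_add"
  assumes "prime p" and "\<not> p dvd c" and "\<And>t. F (t mod p) = F t"
  shows "(\<Sum>t\<in>{0..<p}. F (c * t)) = (\<Sum>t\<in>{0..<p}. F t)"
proof (rule sum_periodic_bij)
  show "[s = t] (mod p)" if "[c * s = c * t] (mod p)" for s t
    using that assms(1,2) prime_dvd_mult_iff[of p c "s - t"]
    by (simp add: cong_iff_dvd_diff right_diff_distrib)
qed (use assms prime_gt_0_int in auto)

section \<open>Primitive roots and power sums modulo a prime\<close>

lemma prime_primitive_root_int:
  assumes p: "prime p"
  shows "\<exists>g :: int. \<forall>k. [g ^ k = 1] (mod int p) \<longleftrightarrow> p - 1 dvd k"
proof -
  obtain g where "residue_primroot p g"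
    using prime_primitive_root_exists[of p] p prime_gt_1_nat[OF p] by auto
  then have "ord p g = p - 1" using p by (simp add: residue_primroot_def totient_prime)
  then have "[g ^ k = 1] (mod p) \<longleftrightarrow> p - 1 dvd k" for k using ord_divides[of g k p] by simp
  then have "[int g ^ k = 1] (mod int p) \<longleftrightarrow> p - 1 dvd k" for k
    by (metis cong_int_iff of_nat_1 of_nat_power)
  then show ?thesis by blast
qed

lemma prime_not_dvd_if_power_cong_1:
  fixes g :: int
  assumes p: "prime p" and "[g ^ j = 1] (mod int p)" and "j > 0"
  shows "\<not> int p dvd g"
proof
  assume "int p dvd g"
  moreover have "g dvd g ^ j" using \<open>j > 0\<close> by (simp add: dvd_power)
  ultimately have "int p dvd g ^ j" by (rule dvd_trans)
  moreover have "int p dvd g ^ j - 1" using assms(2) by (simp add: cong_iff_dvd_diff)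
  ultimately have "int p dvd g ^ j - (g ^ j - 1)" by (rule dvd_diff)
  then show False using prime_gt_1_nat[OF p] by simp
qed

text \<open>Scaling by a primitive root \<open>g\<close> permutes the residues but multiplies the
  sum by \<open>g ^ j\<close>, which is not 1 modulo \<open>p\<close>.\<close>

lemma prime_dvd_power_sum:
  assumes p: "prime p" and j: "\<not> p - 1 dvd j"
  shows "int p dvd (\<Sum>t\<in>{0..<int p}. t ^ j)"
proof -
  obtain g :: int where g: "\<And>k. [g ^ k = 1] (mod int p) \<longleftrightarrow> p - 1 dvd k"
    using prime_primitive_root_int[OF p] by blast
  have pp: "prime (int p)" using p by simp
  have "[g ^ (p - 1) = 1] (mod int p)" using g by simp
  then have "\<not> int p dvd g"
    using prime_gt_1_nat[OF p] by (intro prime_not_dvd_if_power_cong_1[OF p]) auto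
  \<comment> \<open>Reducing each summand makes the function exactly periodic, as
    \<open>sum_periodic_scale\<close> demands.\<close>
  have F: "[(\<Sum>t\<in>{0..<int p}. \<phi> t ^ j) = (\<Sum>t\<in>{0..<int p}. \<phi> t ^ j mod int p)] (mod int p)"
    for \<phi> :: "int \<Rightarrow> int"
    by (rule cong_sum) (simp add: cong_def)
  have "[g ^ j * (\<Sum>t\<in>{0..<int p}. t ^ j) = (\<Sum>t\<in>{0..<int p}. (g * t) ^ j)] (mod int p)"
    by (simp add: power_mult_distrib sum_distrib_left)
  also have "[(\<Sum>t\<in>{0..<int p}. (g * t) ^ j) = (\<Sum>t\<in>{0..<int p}. (g * t) ^ j mod int p)] (mod int p)"
    by (rule F)
  also have "(\<Sum>t\<in>{0..<int p}. (g * t) ^ j mod int p) = (\<Sum>t\<in>{0..<int p}. t ^ j mod int p)"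
    using pp \<open>\<not> int p dvd g\<close> by (rule sum_periodic_scale) (rule power_mod)
  also have "[\<dots> = (\<Sum>t\<in>{0..<int p}. t ^ j)] (mod int p)"
    using F[of "\<lambda>t. t"] by (rule cong_sym)
  finally have "int p dvd (g ^ j - 1) * (\<Sum>t\<in>{0..<int p}. t ^ j)"
    by (simp add: cong_iff_dvd_diff left_diff_distrib)
  moreover have "\<not> int p dvd g ^ j - 1" using g j by (simp add: cong_iff_dvd_diff)
  ultimately show ?thesis using pp by (simp add: prime_dvd_mult_iff)
qed

section \<open>Jacobi sums of cubic characters\<close>

text \<open>A nontrivial cubic character on \<open>\<int>/p\<close>, extended by 0. The Jacobi sum
  relations follow from these axioms without reference to \<open>\<pi>\<close>.\<close>

locale cubic_character =
  fixes p :: nat and X :: "int \<Rightarrow> eisenstein"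
  assumes prime_p: "prime p"
    and X_mod: "X (t mod int p) = X t"
    and X_dvd: "int p dvd t \<Longrightarrow> X t = 0"
    and X_cube: "\<not> int p dvd t \<Longrightarrow> X t ^ 3 = 1"
    and X_mult: "X (s * t) = X s * X t"
    and X_nontrivial: "\<exists>g. \<not> int p dvd g \<and> X g \<noteq> 1"
begin

definition J :: eisenstein
  where "J = (\<Sum>t\<in>{0..<int p}. X t * X (1 - t))"

text \<open>The unit for convolution of \<open>p\<close>-periodic functions, that is, 1 in the group
  ring.\<close>

definition delta :: "int \<Rightarrow> eisenstein"
  where "delta u = (if int p dvd u then 1 else 0)"

lemma prime_int_p: "prime (int p)"
  using prime_p by simp

lemma p_pos: "p > 0"
  using prime_p by (rule prime_gt_0_nat)

lemma X_cong: "[s = t] (mod int p) \<Longrightarrow> X s = X t"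
  by (metis X_mod cong_def)

lemma X_nonzero: "\<not> int p dvd t \<Longrightarrow> X t \<noteq> 0"
  using X_cube by force

lemma not_p_dvd_1: "\<not> int p dvd 1"
  using prime_gt_1_nat[OF prime_p] by simp

lemma X_1: "X 1 = 1"
  using X_mult[of 1 1] X_nonzero[OF not_p_dvd_1] by simp

text \<open>The value at -1 has order dividing both 2 and 3.\<close>

lemma X_minus: "X (- t) = X t"
proof -
  have "X (-1) ^ 2 = 1" using X_mult[of "-1" "-1"] X_1 by (simp add: power2_eq_square)
  moreover have "X (-1) ^ 3 = 1" using X_cube[of "-1"] not_p_dvd_1 by simp
  ultimately have "X (-1) = 1" by (simp add: power2_eq_square power3_eq_cube)
  then show ?thesis using X_mult[of "-1" t] by simp
qed

lemma eis_cnj_X: "eis_cnj (X t) = X t ^ 2"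
  using X_dvd X_cube eis_cnj_cube_root by (cases "int p dvd t") auto

lemma sum_X: "(\<Sum>t\<in>{0..<int p}. X t) = 0"
proof -
  obtain g where g: "\<not> int p dvd g" "X g \<noteq> 1" using X_nontrivial by blast
  have "X g * (\<Sum>t\<in>{0..<int p}. X t) = (\<Sum>t\<in>{0..<int p}. X (g * t))"
    by (simp add: X_mult sum_distrib_left)
  also have "\<dots> = (\<Sum>t\<in>{0..<int p}. X t)"
    by (intro sum_periodic_scale prime_int_p g(1) X_mod)
  finally show ?thesis using g(2) by simp
qed

text \<open>Summation over a period is multiplicative under convolution, and \<open>X\<close> sums
  to 0.\<close>

lemma sum_conv:
  assumes "\<And>t. h (t mod int p) = h t"
  shows "(\<Sum>u\<in>{0..<int p}. conv p X h u) = 0"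
proof -
  have "(\<Sum>u\<in>{0..<int p}. conv p X h u)
      = (\<Sum>t\<in>{0..<int p}. \<Sum>u\<in>{0..<int p}. X t * h (u - t))"
    unfolding conv_def by (rule sum.swap)
  also have "\<dots> = (\<Sum>t\<in>{0..<int p}. X t * (\<Sum>u\<in>{0..<int p}. h u))"
    unfolding sum_distrib_left[symmetric]
    by (intro sum.cong refl) (simp add: sum_periodic_shift p_pos assms)
  also have "\<dots> = 0" by (simp add: sum_X flip: sum_distrib_right)
  finally show ?thesis .
qed

lemma sum_mult_delta:
  "(\<Sum>t\<in>{0..<int p}. f t * delta (u - t)) = f (u mod int p)"
proof -
  have "(\<Sum>t\<in>{0..<int p}. f t * delta (u - t))
     = (\<Sum>t\<in>{0..<int p}. if t = u mod int p then f t else 0)"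
    using p_pos by (intro sum.cong refl)
      (auto simp: delta_def cong_iff_dvd_diff[symmetric] cong_def)
  also have "\<dots> = f (u mod int p)" using p_pos by (subst sum.delta) auto
  finally show ?thesis .
qed

lemma conv_delta: "conv p X delta = X"
  by (rule ext) (simp add: conv_def sum_mult_delta X_mod)

text \<open>Substitute \<open>u * t\<close> for \<open>t\<close>. The exponents cover the
  convolutions of \<open>X\<close> with \<open>X\<close> and with its conjugate
  \<open>X ^ 2\<close>.\<close>

lemma sum_X_scale:
  assumes "\<not> int p dvd u"
  shows "(\<Sum>t\<in>{0..<int p}. X t ^ i * X (u - t) ^ j)
    = X u ^ (i + j) * (\<Sum>t\<in>{0..<int p}. X t ^ i * X (1 - t) ^ j)"
proof -
  have "(\<Sum>t\<in>{0..<int p}. X t ^ i * X (u - t) ^ j)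
      = (\<Sum>t\<in>{0..<int p}. X (u * t) ^ i * X (u - u * t) ^ j)"
  proof (rule sum_periodic_scale[OF prime_int_p assms, of "\<lambda>t. X t ^ i * X (u - t) ^ j", symmetric])
    have "X (u - t mod int p) = X (u - t)" for t
      by (intro X_cong cong_diff) (auto simp: cong_def)
    then show "X (t mod int p) ^ i * X (u - t mod int p) ^ j = X t ^ i * X (u - t) ^ j" for t
      by (simp add: X_mod)
  qed
  also have "\<dots> = (\<Sum>t\<in>{0..<int p}. X u ^ (i + j) * (X t ^ i * X (1 - t) ^ j))"
  proof (intro sum.cong refl)
    show "X (u * t) ^ i * X (u - u * t) ^ j = X u ^ (i + j) * (X t ^ i * X (1 - t) ^ j)" for t
      using X_mult[of u "1 - t"]
      by (simp add: X_mult power_mult_distrib power_add right_diff_distrib mult_ac)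
  qed
  finally show ?thesis by (simp add: sum_distrib_left)
qed

lemma sum_X_cube: "(\<Sum>t\<in>{0..<int p}. X t ^ 3) = of_nat p - 1"
proof -
  have "{0..<int p} = insert 0 {1..<int p}" using p_pos by auto
  moreover have "(\<Sum>t\<in>{1..<int p}. X t ^ 3) = (\<Sum>t\<in>{1..<int p}. 1)"
    by (intro sum.cong refl X_cube) (auto dest: zdvd_imp_le)
  ultimately show ?thesis using p_pos X_dvd[of 0] by (simp add: of_nat_diff)
qed

text \<open>Convolution form of \<open>G(\<chi>) ^ 2 = J G(\<chi> ^ 2)\<close>. At multiples of
  \<open>p\<close> the sum becomes that of the conjugate character, which is 0.\<close>

lemma conv_X: "conv p X X = (\<lambda>u. J * X u ^ 2)"
proof
  fix u
  show "conv p X X u = J * X u ^ 2"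
  proof (cases "int p dvd u")
    case True
    have "X (u - t) = X t" for t
      using X_cong[of "u - t" "- t"] True X_minus by (simp add: cong_iff_dvd_diff)
    then have "conv p X X u = (\<Sum>t\<in>{0..<int p}. eis_cnj (X t))"
      by (simp add: conv_def eis_cnj_X power2_eq_square)
    also have "\<dots> = 0" by (simp add: sum_X flip: eis_cnj_sum)
    finally show ?thesis using True X_dvd by simp
  next
    case False
    then show ?thesis using sum_X_scale[of u 1 1] by (simp add: conv_def J_def numeral_2_eq_2 mult_ac)
  qed
qed

text \<open>Convolution form of \<open>G(\<chi>) G(cnj \<chi>) = p\<close>. The constant function -1
  is the part that vanishes on inserting a nontrivial \<open>p\<close>-th root of unity.\<close>

lemma conv_X_square: "conv p X (\<lambda>u. X u ^ 2) = (\<lambda>u. of_nat p * delta u - 1)"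
proof -
  define K where "K = (\<Sum>t\<in>{0..<int p}. X t * X (1 - t) ^ 2)"
  have 0: "conv p X (\<lambda>u. X u ^ 2) u = of_nat p - 1" if "int p dvd u" for u
  proof -
    have "X (u - t) = X t" for t
      using X_cong[of "u - t" "- t"] that X_minus by (simp add: cong_iff_dvd_diff)
    then show ?thesis
      using sum_X_cube by (simp add: conv_def power2_eq_square power3_eq_cube mult.assoc)
  qed
  have 1: "conv p X (\<lambda>u. X u ^ 2) u = K" if "\<not> int p dvd u" for u
    using sum_X_scale[OF that, of 1 2] X_cube[OF that] by (simp add: conv_def K_def) (simp add: power3_eq_cube mult.assoc)
  \<comment> \<open>The value away from 0 is constant, and the sum of all values vanishes.\<close>
  have "0 = (\<Sum>u\<in>{0..<int p}. conv p X (\<lambda>u. X u ^ 2) u)"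
    by (rule sum_conv[symmetric]) (simp add: X_mod)
  also have "{0..<int p} = insert 0 {1..<int p}" using p_pos by auto
  also have "(\<Sum>u\<in>\<dots>. conv p X (\<lambda>u. X u ^ 2) u) = of_nat p - 1 + (\<Sum>u\<in>{1..<int p}. K)"
  proof -
    have "(\<Sum>u\<in>{1..<int p}. conv p X (\<lambda>u. X u ^ 2) u) = (\<Sum>u\<in>{1..<int p}. K)"
      by (intro sum.cong refl 1) (auto dest: zdvd_imp_le)
    then show ?thesis using 0[of 0] by simp
  qed
  also have "\<dots> = of_int (int p - 1) * (1 + K)"
    using p_pos by (simp add: of_nat_diff algebra_simps)
  finally have "of_int (int p - 1) = (of_int 0 :: eisenstein) \<or> 1 + K = 0" by simp
  then have "1 + K = 0"
    unfolding of_int_eisenstein_inject using prime_gt_1_nat[OF prime_p] by simp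
  then have K: "K = -1" by (simp add: add_eq_0_iff)
  show ?thesis
    by (rule ext) (simp add: delta_def 0 1 K)
qed

lemma conv_conv_X:
  "conv p X (conv p X X) = (\<lambda>u. J * (of_nat p * delta u - 1))"
  unfolding conv_X conv_cmult conv_X_square ..

text \<open>Convolution with \<open>X\<close> annihilates constants, so only the scalar
  \<open>p\<close> survives.\<close>

lemma conv_p_delta_minus_1: "conv p X (\<lambda>u. of_nat p * delta u - 1) = (\<lambda>u. of_nat p * X u)"
proof
  fix u
  have "conv p X (\<lambda>u. of_nat p * delta u - 1) u
      = of_nat p * conv p X delta u - (\<Sum>t\<in>{0..<int p}. X t)"
    by (simp add: conv_def right_diff_distrib sum_subtractf sum_distrib_left mult_ac)
  then show "conv p X (\<lambda>u. of_nat p * delta u - 1) u = of_nat p * X u"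
    by (simp add: conv_delta sum_X)
qed

text \<open>This is \<open>G ^ (3 m + 1) = (p J) ^ m G\<close>. The extra factor \<open>X\<close>
  absorbs the constant that spoils \<open>G ^ 3 = p J\<close> at the level of functions.\<close>

lemma conv_power_1:
  "(conv p X ^^ (3 * m + 1)) delta = (\<lambda>u. (of_nat p * J) ^ m * X u)"
proof (induction m)
  case (Suc m)
  have "(conv p X ^^ (3 * Suc m + 1)) delta
      = conv p X (conv p X (conv p X ((conv p X ^^ (3 * m + 1)) delta)))"
    by (simp add: numeral_3_eq_3)
  then show ?case
    unfolding Suc.IH conv_cmult conv_conv_X conv_p_delta_minus_1 by (simp add: mult_ac)
qed (simp add: conv_delta)

lemma conv_power_2:
  "(conv p X ^^ (3 * m + 2)) delta = (\<lambda>u. (of_nat p * J) ^ m * (J * X u ^ 2))"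
proof -
  have "(conv p X ^^ (3 * m + 2)) delta = conv p X ((conv p X ^^ (3 * m + 1)) delta)"
    by simp
  then show ?thesis unfolding conv_power_1 conv_cmult conv_X .
qed

text \<open>In Gauss sum notation, \<open>G ^ q \<equiv> \<chi>(q) ^ (- q) G(\<chi> ^ q)\<close>, read off at the coefficient of \<open>\<zeta> ^ q\<close>.\<close>

lemma conv_power_prime:
  assumes q: "prime q" and "q \<noteq> p"
  shows "ring_cong (of_nat q) ((conv p X ^^ q) delta (int q)) 1"
proof -
  have "\<not> int p dvd int q" using assms prime_p primes_dvd_imp_eq[of p q] by auto
  have "ring_cong (of_nat q) ((conv p X ^^ q) delta (int q))
      (\<Sum>t\<in>{0..<int p}. X t ^ q * delta (int q - int q * t))"
    by (rule conv_frobenius[OF q])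
  also have "(\<Sum>t\<in>{0..<int p}. X t ^ q * delta (int q - int q * t))
      = (\<Sum>t\<in>{0..<int p}. X t ^ q * delta (1 - t))"
  proof (intro sum.cong refl)
    have "int q - int q * t = int q * (1 - t)" for t by (simp add: algebra_simps)
    then show "X t ^ q * delta (int q - int q * t) = X t ^ q * delta (1 - t)" for t
      using \<open>\<not> int p dvd int q\<close> prime_int_p by (simp add: delta_def prime_dvd_mult_iff)
  qed
  also have "\<dots> = 1" by (simp add: sum_mult_delta X_mod X_1)
  finally show ?thesis .
qed

text \<open>Convolve \<open>X\<close> with both \<open>X\<close> and its conjugate, in either order.\<close>

lemma J_norm: "J * eis_cnj J = of_nat p"
proof -
  have cnj: "conv p (\<lambda>u. X u ^ 2) (\<lambda>u. eis_cnj (h u)) = (\<lambda>u. eis_cnj (conv p X h u))" for h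
    by (rule ext) (simp add: conv_def eis_cnj_sum eis_cnj_X)
  have X4: "(X u ^ 2) ^ 2 = X u" for u
    using eis_cnj_cnj[of "X u"] by (simp add: eis_cnj_X)
  then have X4': "X u ^ 4 = X u" for u by simp
  have "conv p (\<lambda>u. X u ^ 2) (\<lambda>u. X u ^ 2) = (\<lambda>u. eis_cnj J * X u)"
    using cnj[of X] unfolding conv_X by (simp add: eis_cnj_X X4')
  \<comment> \<open>First order: \<open>X\<close> with itself gives \<open>J\<close>, then the
    conjugate with itself gives \<open>eis_cnj J\<close>.\<close>
  then have 1: "conv p (\<lambda>u. X u ^ 2) (conv p X X) 1 = J * eis_cnj J"
    unfolding conv_X conv_cmult by (simp add: X_1)
  have cnj_delta: "eis_cnj (delta u) = delta u" for u by (simp add: delta_def)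
  have "(\<lambda>u. eis_cnj (X u ^ 2)) = X" by (simp add: eis_cnj_X X4')
  then have "conv p (\<lambda>u. X u ^ 2) X = (\<lambda>u. of_nat p * delta u - 1)"
    using cnj[of "\<lambda>u. X u ^ 2"] unfolding conv_X_square by (simp add: cnj_delta)
  \<comment> \<open>Second order: \<open>X\<close> with its conjugate gives \<open>p\<close> up to a
    constant, which \<open>X\<close> annihilates.\<close>
  then have "conv p (\<lambda>u. X u ^ 2) (conv p X X) 1 = of_nat p"
    unfolding conv_commute[of p "\<lambda>u. X u ^ 2"] by (simp add: conv_p_delta_minus_1 X_1)
  then show ?thesis using 1 by simp
qed

text \<open>Frobenius for the exponent 3: at the argument 3, nonzero modulo \<open>p\<close>, the
  triple convolution has the value \<open>- J\<close>.\<close>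

lemma J_mod_3:
  assumes "p \<noteq> 3"
  shows "ring_cong 3 J (-1)"
proof -
  have "\<not> int p dvd 3"
    using assms prime_p primes_dvd_imp_eq[of p 3] int_dvd_int_iff[of p 3] by auto
  then have "(conv p X ^^ 3) delta 3 = - J"
    using conv_conv_X by (simp add: numeral_3_eq_3 conv_delta) (simp add: delta_def)
  then have "ring_cong 3 (- J) 1"
    using conv_power_prime[of 3] assms by auto
  moreover have "J - (-1) = - (- J - 1)" by simp
  ultimately show ?thesis unfolding ring_cong_def by (metis dvd_minus_iff)
qed

end

text \<open>Modulo 3 the second coordinate of \<open>\<pi> * u\<close> is \<open>a * d\<close>, so 3
  divides \<open>d\<close>; norm 1 then forces \<open>d = 0\<close>.\<close>

lemma eis_primary_associate:
  assumes pi: "\<pi> = of_int a + of_int b * omega" and b: "3 dvd b" and a: "\<not> 3 dvd a"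
    and u: "eis_norm u = 1" and cong: "ring_cong 3 (\<pi> * u) (-1)"
  shows "u = 1 \<or> u = -1"
proof -
  obtain c d where u': "u = of_int c + of_int d * omega" by (rule eisenstein_cases)
  have "\<pi> * u - (-1) = of_int (a * c) + of_int (a * d + b * c) * omega
      + of_int (b * d) * (omega * omega) + 1"
    unfolding pi u' by (simp add: algebra_simps)
  also have "\<dots> = of_int (a * c - b * d + 1) + of_int (a * d + b * c - b * d) * omega"
    unfolding omega_square by (simp add: algebra_simps)
  finally have "of_int 3 dvd (of_int (a * c - b * d + 1) + of_int (a * d + b * c - b * d) * omega)"
    using cong unfolding ring_cong_def by (simp only: of_int_numeral)
  then have "3 dvd a * d + b * c - b * d" unfolding of_int_dvd_eis_iff by blast
  moreover have "a * d = (a * d + b * c - b * d) - b * (c - d)" by (simp add: algebra_simps)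
  ultimately have "3 dvd a * d" using b by (metis dvd_diff dvd_mult2)
  then have "3 dvd d" using a by (simp add: prime_dvd_mult_iff)
  then obtain e where e: "d = 3 * e" by blast
  have "(of_int 1 :: eisenstein) = of_int (c\<^sup>2 - c * d + d\<^sup>2)"
    using eis_norm_correct[of u] u mult_eis_cnj_coords[of c d] by (simp add: u')
  then have "c\<^sup>2 - c * d + d\<^sup>2 = 1" unfolding of_int_eisenstein_inject by simp
  \<comment> \<open>Four times the norm form, with the square completed; since 27 exceeds 4, only
    \<open>e = 0\<close> is left.\<close>
  then have n: "(2 * c - d)\<^sup>2 + 27 * e\<^sup>2 = 4" by (simp add: e power2_eq_square algebra_simps)
  moreover have "0 \<le> (2 * c - d)\<^sup>2" by simp
  ultimately have "e\<^sup>2 \<le> 0" by linarith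
  then have "e = 0" by (simp add: power2_le_iff_abs_le)
  with n e have "c\<^sup>2 = 1" by (simp add: power_mult_distrib)
  then have "c = 1 \<or> c = -1" by (simp add: power2_eq_1_iff)
  then show ?thesis using u' e \<open>e = 0\<close> by auto
qed

section \<open>The cubic residue character modulo a prime of norm \<open>p\<close>, and rational
  cubic reciprocity\<close>

locale cubic_residue =
  fixes p :: nat and \<pi> :: eisenstein
  assumes prime_p: "prime p" and p_mod_3: "[p = 1] (mod 3)" and norm_pi: "eis_norm \<pi> = p"
begin

definition k :: nat where "k = (p - 1) div 3"

definition X :: "int \<Rightarrow> eisenstein" where "X t = cubic_char \<pi> (of_int t)"

lemma p_gt_3: "p > 3"
proof -
  have "p mod 3 = 1" "p > 1" using p_mod_3 prime_gt_1_nat[OF prime_p] by (simp_all add: cong_def)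
  then show ?thesis by presburger
qed

lemma three_k: "3 * k = p - 1" and k_pos: "k > 0"
proof -
  have "p mod 3 = 1" using p_mod_3 by (simp add: cong_def)
  then show "3 * k = p - 1" unfolding k_def by presburger
  then show "k > 0" using p_gt_3 by simp
qed

lemma pi_dvd_of_int: "\<pi> dvd of_int t \<longleftrightarrow> int p dvd t"
  using dvd_of_int_iff[of \<pi> t] prime_p norm_pi by simp

lemma X_unique:
  assumes "\<not> int p dvd t"
  shows "\<exists>!c. c \<in> {1, omega, eis_cnj omega} \<and> \<pi> dvd (of_int t ^ k - c)"
  using cubic_char_unique[of \<pi> "of_int t"] assms prime_p p_mod_3
  by (simp add: norm_pi pi_dvd_of_int k_def)

lemma X_eq_The:
  assumes "\<not> int p dvd t"
  shows "X t = (THE c. c \<in> {1, omega, eis_cnj omega} \<and> \<pi> dvd (of_int t ^ k - c))"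
  using assms by (simp add: X_def cubic_char_def norm_pi pi_dvd_of_int k_def)

lemma X_spec:
  assumes "\<not> int p dvd t"
  shows "X t ^ 3 = 1 \<and> ring_cong \<pi> (of_int t ^ k) (X t)"
  using theI'[OF X_unique[OF assms]]
  unfolding X_eq_The[OF assms] eis_cube_roots_of_unity ring_cong_def .

lemmas X_cube = X_spec[THEN conjunct1] and X_cong_power_unit = X_spec[THEN conjunct2]

text \<open>Uniqueness of the symbol reduces identities for \<open>X\<close> to congruences of
  \<open>k\<close>-th powers modulo \<open>\<pi>\<close>.\<close>

lemma X_eqI: "\<not> int p dvd t \<Longrightarrow> c ^ 3 = 1 \<Longrightarrow> ring_cong \<pi> (of_int t ^ k) c \<Longrightarrow> X t = c"
  unfolding eis_cube_roots_of_unity ring_cong_def X_eq_The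
  by (rule the1_equality[OF X_unique]) auto

lemma X_dvd: "int p dvd t \<Longrightarrow> X t = 0"
  by (simp add: X_def cubic_char_def pi_dvd_of_int)

lemma X_cong_power: "ring_cong \<pi> (of_int t ^ k) (X t)"
proof (cases "int p dvd t")
  case True
  then have "\<pi> dvd of_int t" by (simp add: pi_dvd_of_int)
  then have "\<pi> dvd of_int t ^ k" using k_pos by (metis dvd_power dvd_trans)
  then show ?thesis using True by (simp add: X_dvd ring_cong_def)
qed (rule X_cong_power_unit)

sublocale cubic_character p X
proof
  have pp: "prime (int p)" using prime_p by simp
  show "X (t mod int p) = X t" for t
  proof (cases "int p dvd t")
    case True
    then show ?thesis by (simp add: X_dvd)
  next
    case False
    have "\<pi> dvd of_int (t mod int p - t)"
      unfolding pi_dvd_of_int by (metis cong_iff_dvd_diff cong_mod_left cong_refl)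
    then have "ring_cong \<pi> (of_int (t mod int p)) (of_int t)" by (simp add: ring_cong_def)
    then have "ring_cong \<pi> (of_int (t mod int p) ^ k) (X t)"
      by (rule ring_cong_trans[OF ring_cong_power X_cong_power])
    then show ?thesis using False by (intro X_eqI X_cube) (auto simp: dvd_mod_iff)
  qed
  show "X (s * t) = X s * X t" for s t
  proof (cases "int p dvd s \<or> int p dvd t")
    case True
    then show ?thesis by (auto simp: X_dvd)
  next
    case False
    have "ring_cong \<pi> (of_int (s * t) ^ k) (X s * X t)"
      using ring_cong_mult[OF X_cong_power[of s] X_cong_power[of t]] by (simp add: power_mult_distrib)
    then show ?thesis using False pp
      by (intro X_eqI) (auto simp: prime_dvd_mult_iff power_mult_distrib X_cube)
  qed
  show "\<exists>g. \<not> int p dvd g \<and> X g \<noteq> 1"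
  proof -
    obtain g :: int where g: "\<And>j. [g ^ j = 1] (mod int p) \<longleftrightarrow> p - 1 dvd j"
      using prime_primitive_root_int[OF prime_p] by blast
    \<comment> \<open>\<open>k\<close> lies strictly between 0 and \<open>p - 1\<close>, so the
      \<open>k\<close>-th power of a primitive root is not 1 modulo \<open>p\<close>.\<close>
    have "\<not> p - 1 dvd k" using three_k k_pos by (auto dest: dvd_imp_le)
    then have "\<not> int p dvd g ^ k - 1" using g by (simp add: cong_iff_dvd_diff)
    then have "X g \<noteq> 1"
      using X_cong_power[of g] pi_dvd_of_int[of "g ^ k - 1"] by (auto simp: ring_cong_def)
    moreover have "[g ^ (p - 1) = 1] (mod int p)" using g by simp
    then have "\<not> int p dvd g"
      using p_gt_3 by (intro prime_not_dvd_if_power_cong_1[OF prime_p]) auto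
    ultimately show ?thesis by blast
  qed
qed (fact prime_p X_dvd X_cube)+

text \<open>Modulo \<open>\<pi>\<close> the Jacobi sum is the sum of
  \<open>t ^ k * (1 - t) ^ k\<close> over all residues, a combination of power sums that vanish
  modulo \<open>p\<close>.\<close>

lemma pi_dvd_J: "\<pi> dvd J"
proof -
  let ?c = "\<lambda>j. (-1) ^ j * int (k choose j)"
  have "ring_cong \<pi> J (\<Sum>t\<in>{0..<int p}. of_int t ^ k * of_int (1 - t) ^ k)"
    unfolding J_def by (intro ring_cong_sum ring_cong_mult ring_cong_sym[OF X_cong_power])
  also have "\<dots> = of_int (\<Sum>t\<in>{0..<int p}. t ^ k * (1 - t) ^ k)" by simp
  also have "(\<Sum>t\<in>{0..<int p}. t ^ k * (1 - t) ^ k)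
      = (\<Sum>t\<in>{0..<int p}. \<Sum>j\<le>k. ?c j * t ^ (k + j))"
  proof (intro sum.cong refl)
    fix t :: int
    have "(1 - t) ^ k = (- t + 1) ^ k" by simp
    also have "\<dots> = (\<Sum>j\<le>k. of_nat (k choose j) * (- t) ^ j * 1 ^ (k - j))" by (rule binomial_ring)
    finally show "t ^ k * (1 - t) ^ k = (\<Sum>j\<le>k. ?c j * t ^ (k + j))"
      by (simp add: sum_distrib_left power_minus[of t] power_add mult_ac)
  qed
  also have "\<dots> = (\<Sum>j\<le>k. ?c j * (\<Sum>t\<in>{0..<int p}. t ^ (k + j)))"
    unfolding sum_distrib_left by (rule sum.swap)
  finally have *: "ring_cong \<pi> J (of_int (\<Sum>j\<le>k. ?c j * (\<Sum>t\<in>{0..<int p}. t ^ (k + j))))" .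
  have "int p dvd (\<Sum>j\<le>k. ?c j * (\<Sum>t\<in>{0..<int p}. t ^ (k + j)))"
  proof (rule dvd_sum, rule dvd_mult)
    fix j assume "j \<in> {..k}"
    \<comment> \<open>The exponent is positive and at most \<open>2 * k\<close>, below
      \<open>3 * k = p - 1\<close>.\<close>
    then have "\<not> p - 1 dvd k + j" using three_k k_pos by (auto dest!: dvd_imp_le)
    then show "int p dvd (\<Sum>t\<in>{0..<int p}. t ^ (k + j))" by (rule prime_dvd_power_sum[OF prime_p])
  qed
  then show ?thesis
    unfolding pi_dvd_of_int[symmetric] by (rule ring_cong_dvd[OF *])
qed

lemma eis_norm_J: "eis_norm J = p"
proof -
  have "(of_int (int (eis_norm J)) :: eisenstein) = of_int (int p)"
    using eis_norm_correct[of J] J_norm by simp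
  then show ?thesis unfolding of_int_eisenstein_inject by simp
qed

lemma pi_mult_cnj: "\<pi> * eis_cnj \<pi> = of_nat p"
  using eis_norm_correct[of \<pi>] norm_pi by simp

text \<open>\<open>\<pi>\<close> divides \<open>J\<close> and the norms agree, so they differ by a
  unit, which \<open>J \<equiv> -1\<close> modulo 3 restricts to a sign. Squaring removes the
  sign.\<close>

lemma J_square:
  assumes pi: "\<pi> = of_int a + of_int b * omega" and b: "3 dvd b"
  shows "J ^ 2 = \<pi> ^ 2"
proof -
  obtain u where u: "J = \<pi> * u" using pi_dvd_J by blast
  have "p * eis_norm u = p" using eis_norm_mult[of \<pi> u] u eis_norm_J norm_pi by simp
  then have "eis_norm u = 1" using p_gt_3 by simp
  have "(of_int (int p) :: eisenstein) = of_int (a\<^sup>2 - a * b + b\<^sup>2)"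
    using pi_mult_cnj mult_eis_cnj_coords[of a b] pi by simp
  then have n: "int p = a * a + b * (b - a)"
    unfolding of_int_eisenstein_inject by (simp add: power2_eq_square algebra_simps)
  have "\<not> 3 dvd a"
  proof
    assume "3 dvd a"
    then have "3 dvd int p" unfolding n using b by simp
    then have "3 dvd p" by presburger
    then show False using p_mod_3 by (simp add: cong_def dvd_eq_mod_eq_0)
  qed
  moreover have "ring_cong 3 (\<pi> * u) (-1)" using J_mod_3 p_gt_3 u by simp
  ultimately have "u = 1 \<or> u = -1"
    using eis_primary_associate[OF pi b] \<open>eis_norm u = 1\<close> by blast
  then show ?thesis using u by auto
qed

text \<open>Two values of the \<open>q\<close>-fold convolution at \<open>q\<close> are compared: 1
  modulo \<open>q\<close> by Frobenius, and the closed form in \<open>p\<close>, \<open>J\<close>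
  and \<open>X (int q)\<close>.\<close>

lemma rational_cubic_reciprocity:
  assumes pi: "\<pi> = of_int a + of_int b * omega" "3 dvd b"
    and q: "prime q" "q > 3" "q \<noteq> p" and n: "3 * n = q\<^sup>2 - 1"
  shows "ring_cong (of_nat q) (X (int q) * \<pi> ^ n) (eis_cnj \<pi> ^ n)"
proof -
  let ?c = "X (int q)"
  have nd: "\<not> int p dvd int q" using q prime_p primes_dvd_imp_eq[of p q] by auto
  have c3: "?c ^ 3 = 1" using nd by (rule X_cube)
  have "\<not> q dvd p" using q prime_p primes_dvd_imp_eq[of q p] by auto
  then have qn: "\<not> q dvd eis_norm \<pi>" by (simp add: norm_pi)
  have q3: "\<not> 3 dvd q" using q primes_dvd_imp_eq[of 3 q] by auto
  \<comment> \<open>Oddness makes the exponent of \<open>J\<close> even in both cases, so that only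
    \<open>J ^ 2\<close> enters.\<close>
  have qodd: "odd q" using q primes_dvd_imp_eq[of 2 q] by auto
  have J2: "J ^ (2 * i) = \<pi> ^ (2 * i)" for i
    unfolding power_mult J_square[OF pi] ..
  have "q mod 3 = 1 \<or> q mod 3 = 2" using q3 by presburger
  then consider "q mod 3 = 1" | "q mod 3 = 2" by blast
  then show ?thesis
  proof cases
    case 1
    define m where "m = q div 6"
    have m: "q = 3 * (2 * m) + 1" using 1 qodd unfolding m_def by presburger
    have "3 * n = 3 * (2 * m * (q + 1))" unfolding n m by (simp add: power2_eq_square algebra_simps)
    then have n': "n = 2 * m * (q + 1)" by simp
    have "(conv p X ^^ q) delta (int q) = (of_nat p * J) ^ (2 * m) * ?c"
      unfolding m conv_power_1 by simp
    also have "(of_nat p * J) ^ (2 * m) = (\<pi> ^ 2 * eis_cnj \<pi>) ^ (2 * m)"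
      unfolding power_mult_distrib J2 pi_mult_cnj[symmetric] by (simp add: power2_eq_square power_mult_distrib mult_ac)
    finally have "ring_cong (of_nat q) ((\<pi> ^ 2 * eis_cnj \<pi>) ^ (2 * m) * ?c) 1"
      using conv_power_prime[OF q(1,3)] by simp
    \<comment> \<open>The power \<open>q + 1\<close> brings the exponent \<open>2 * m\<close> up to
      \<open>n\<close>.\<close>
    then have "ring_cong (of_nat q) (((\<pi> ^ 2 * eis_cnj \<pi>) ^ (2 * m) * ?c) ^ (q + 1)) (1 ^ (q + 1))"
      by (rule ring_cong_power)
    also have "((\<pi> ^ 2 * eis_cnj \<pi>) ^ (2 * m) * ?c) ^ (q + 1)
        = (\<pi> ^ 2 * eis_cnj \<pi>) ^ n * ?c ^ (q + 1)"
      unfolding n' power_mult_distrib power_mult ..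
    also have "q + 1 = 3 * (2 * m) + 2" using m by simp
    also have "?c ^ \<dots> = ?c ^ 2" unfolding power_add power_mult c3 by simp
    finally have "ring_cong (of_nat q) ((\<pi> ^ 2 * eis_cnj \<pi>) ^ n * ?c ^ 2) 1" by simp
    \<comment> \<open>This factor completes the cubes: \<open>?c ^ 3 = 1\<close> and
      \<open>\<pi> ^ (3 * n) \<equiv> 1\<close>.\<close>
    from ring_cong_sym[OF ring_cong_mult_left[OF this, of "?c * \<pi> ^ n"]]
    have "ring_cong (of_nat q) (?c * \<pi> ^ n) (?c * \<pi> ^ n * ((\<pi> ^ 2 * eis_cnj \<pi>) ^ n * ?c ^ 2))"
      by simp
    also have "\<dots> = ?c ^ 3 * ((\<pi> ^ 3) ^ n * eis_cnj \<pi> ^ n)"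
      by (simp add: power2_eq_square power3_eq_cube power_mult_distrib mult_ac)
    also have "\<dots> = \<pi> ^ (q\<^sup>2 - 1) * eis_cnj \<pi> ^ n" unfolding c3 n[symmetric] power_mult by simp
    also have "ring_cong (of_nat q) \<dots> (1 * eis_cnj \<pi> ^ n)"
      by (intro ring_cong_mult eis_power_square_minus_1 q q3 qn) simp
    finally show ?thesis by simp
  next
    case 2
    define m where "m = q div 6"
    have m: "q = 3 * (2 * m + 1) + 2" using 2 qodd unfolding m_def by presburger
    have "3 * n = 3 * ((2 * m + 1) * q + (4 * m + 3))"
      unfolding n m by (simp add: power2_eq_square algebra_simps)
    then have n': "n = (2 * m + 1) * q + (4 * m + 3)" by simp
    have "(conv p X ^^ q) delta (int q) = (of_nat p * J) ^ (2 * m + 1) * (J * ?c ^ 2)"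
      unfolding m conv_power_2 by simp
    also have "\<dots> = of_nat p ^ (2 * m + 1) * J ^ (2 * (m + 1)) * ?c ^ 2"
      by (simp add: power_mult_distrib power2_eq_square mult_ac)
    also have "\<dots> = \<pi> ^ (4 * m + 3) * eis_cnj \<pi> ^ (2 * m + 1) * ?c ^ 2"
    proof -
      have "4 * m + 3 = (2 * m + 1) + 2 * (m + 1)" by simp
      then have e: "\<pi> ^ (4 * m + 3) = \<pi> ^ (2 * m + 1) * \<pi> ^ (2 * (m + 1))" by (metis power_add)
      show ?thesis unfolding J2 e pi_mult_cnj[symmetric] power_mult_distrib by (simp only: mult_ac)
    qed
    finally have A: "ring_cong (of_nat q) (\<pi> ^ (4 * m + 3) * eis_cnj \<pi> ^ (2 * m + 1) * ?c ^ 2) 1"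
      using conv_power_prime[OF q(1,3)] by simp
    \<comment> \<open>Frobenius is conjugation here; trading each \<open>eis_cnj \<pi>\<close> for
      \<open>\<pi> ^ q\<close> collects all factors into \<open>\<pi> ^ n\<close>.\<close>
    have "ring_cong (of_nat q) (\<pi> ^ q) (eis_cnj \<pi>)"
      using eis_frobenius[OF q(1) q3, of \<pi>] 2 by simp
    then have "ring_cong (of_nat q) (\<pi> ^ (4 * m + 3) * (\<pi> ^ q) ^ (2 * m + 1) * ?c ^ 2)
        (\<pi> ^ (4 * m + 3) * eis_cnj \<pi> ^ (2 * m + 1) * ?c ^ 2)"
      by (intro ring_cong_mult ring_cong_power) simp_all
    then have "ring_cong (of_nat q) (\<pi> ^ (4 * m + 3) * (\<pi> ^ q) ^ (2 * m + 1) * ?c ^ 2) 1"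
      by (rule ring_cong_trans[OF _ A])
    moreover have "\<pi> ^ n = \<pi> ^ (4 * m + 3) * (\<pi> ^ q) ^ (2 * m + 1)"
      unfolding n' power_add[symmetric] power_mult[symmetric] by (simp add: algebra_simps)
    ultimately have "ring_cong (of_nat q) (\<pi> ^ n * ?c ^ 2) 1" by simp
    from ring_cong_mult_left[OF this, of ?c]
    have "ring_cong (of_nat q) (?c ^ 3 * \<pi> ^ n) ?c"
      by (simp add: power2_eq_square power3_eq_cube mult_ac)
    then have 1: "ring_cong (of_nat q) (\<pi> ^ n) ?c" by (simp add: c3)
    then have 2: "ring_cong (of_nat q) (eis_cnj \<pi> ^ n) (?c ^ 2)"
      using ring_cong_cnj[of "int q" "\<pi> ^ n" ?c] by (simp add: eis_cnj_X)
    have "ring_cong (of_nat q) (?c * \<pi> ^ n) (?c * ?c)" using 1 by (rule ring_cong_mult_left)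
    also have "ring_cong (of_nat q) (?c * ?c) (eis_cnj \<pi> ^ n)"
      using ring_cong_sym[OF 2] by (simp add: power2_eq_square)
    finally show ?thesis .
  qed
qed

end

section \<open>The cubic criterion\<close>

definition theta :: eisenstein where "theta = 1 + 2 * omega"

lemma theta_square: "theta * theta = -3"
proof -
  have "theta * theta = 1 + 4 * omega + 4 * (omega * omega)" by (simp add: theta_def algebra_simps)
  then show ?thesis unfolding omega_square by (simp add: algebra_simps)
qed

lemma eis_cnj_theta [simp]: "eis_cnj theta = - theta"
  by (simp add: eis_cnj_omega theta_def)

lemma two_omega: "2 * omega = theta - 1"
  by (simp add: theta_def)

context
  fixes q :: nat
  assumes q: "prime q" and q_gt_3: "q > 3"
begin

lemma three_not_dvd_q: "\<not> 3 dvd q"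
  using q q_gt_3 primes_dvd_imp_eq[of 3 q] by auto

lemma q_not_dvd_int: "\<not> int q dvd 2" "\<not> int q dvd 3"
  using q_gt_3 zdvd_imp_le[of "int q" 2] zdvd_imp_le[of "int q" 3] by auto

lemma prime_int_q: "prime (int q)"
  using q by simp

lemma q_dvd_int_mult: "int q dvd a * b \<longleftrightarrow> int q dvd a \<or> int q dvd b"
  using prime_int_q by (simp add: prime_dvd_mult_iff)

text \<open>4 is a unit modulo \<open>q\<close>; this later clears the denominators of
  \<open>\<rho> * omega\<close> as an expression in \<open>theta\<close>.\<close>

lemma q_dvd_mult_4: "of_nat q dvd 4 * (x :: eisenstein) \<longleftrightarrow> of_nat q dvd x"
proof -
  have "\<not> int q dvd 4" using q_dvd_int_mult[of 2 2] q_not_dvd_int by simp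
  moreover obtain a b where x: "x = of_int a + of_int b * omega" by (rule eisenstein_cases)
  moreover have "4 * x = of_int (4 * a) + of_int (4 * b) * omega" by (simp add: x algebra_simps)
  ultimately show ?thesis
    using of_int_dvd_eis_iff[of "int q" "4 * a" "4 * b"] of_int_dvd_eis_iff[of "int q" a b]
    by (simp add: q_dvd_int_mult mult.assoc)
qed

lemma ring_cong_power_cnj_if_cubic:
  assumes n: "3 * n = q\<^sup>2 - 1" and \<alpha>: "\<not> q dvd eis_norm \<alpha>"
    and t: "ring_cong (of_nat q) ((of_int t + theta) ^ 3 * \<alpha>) (eis_cnj ((of_int t + theta) ^ 3 * \<alpha>))"
  shows "ring_cong (of_nat q) (\<alpha> ^ n) (eis_cnj \<alpha> ^ n)"
proof -
  define z where "z = of_int t + theta"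
  \<comment> \<open>For \<open>q \<equiv> 1\<close> modulo 3 some \<open>t + \<theta>\<close> are zero divisors modulo \<open>q\<close>; these never satisfy the congruence.\<close>
  have "\<not> q dvd eis_norm z"
  proof
    assume "q dvd eis_norm z"
    then have "of_nat q dvd z * eis_cnj z" unfolding eis_norm_correct[symmetric] by (auto elim!: dvdE)
    then have zz: "of_nat q dvd z * eis_cnj z * x" for x by (rule dvd_mult2)
    \<comment> \<open>The factor \<open>z\<close> brings in its norm, so
      \<open>\<alpha> * z ^ 4\<close> vanishes modulo \<open>q\<close>. Without nilpotents this
      gives \<open>z \<equiv> 0\<close>, but its \<open>omega\<close>-coordinate is 2.\<close>
    have "ring_cong (of_nat q) (z * (z ^ 3 * \<alpha>)) (z * eis_cnj (z ^ 3 * \<alpha>))"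
      using t unfolding z_def by (rule ring_cong_mult_left)
    also have "z * eis_cnj (z ^ 3 * \<alpha>) = z * eis_cnj z * (eis_cnj z ^ 2 * eis_cnj \<alpha>)"
      by (simp add: power2_eq_square power3_eq_cube mult_ac)
    also have "ring_cong (of_nat q) \<dots> 0" using zz by (simp add: ring_cong_def)
    also have "z * (z ^ 3 * \<alpha>) = \<alpha> * z ^ 4" by (simp add: eval_nat_numeral mult_ac)
    finally have "ring_cong (of_nat q) (\<alpha> * z ^ 4) (\<alpha> * 0)" by simp
    moreover obtain y where "ring_cong (of_nat q) (\<alpha> * y) 1"
      using eis_unit_mod[OF q \<alpha>] .
    ultimately have "ring_cong (of_nat q) (z ^ 4) 0" using ring_cong_cancel by blast
    moreover have "4 \<le> q\<^sup>2" using q_gt_3 power_mono[of 2 q 2] by simp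
    ultimately have "ring_cong (of_nat q) z 0"
      using eis_cong_0_of_power[OF q three_not_dvd_q] by blast
    moreover have "z = of_int (t + 1) + of_int 2 * omega" by (simp add: z_def theta_def)
    ultimately have "int q dvd 2"
      using of_int_dvd_eis_iff[of "int q" "t + 1" 2] by (simp add: ring_cong_def)
    then show False using q_not_dvd_int by blast
  qed
  then have 1: "ring_cong (of_nat q) (z ^ (3 * n)) 1"
    unfolding n by (rule eis_power_square_minus_1[OF q three_not_dvd_q])
  then have 2: "ring_cong (of_nat q) (eis_cnj z ^ (3 * n)) 1"
    using ring_cong_cnj[of "int q" "z ^ (3 * n)" 1] by simp
  have "ring_cong (of_nat q) (1 * \<alpha> ^ n) (z ^ (3 * n) * \<alpha> ^ n)"
    by (intro ring_cong_mult ring_cong_sym[OF 1] ring_cong_refl)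
  also have "z ^ (3 * n) * \<alpha> ^ n = (z ^ 3 * \<alpha>) ^ n" by (simp add: power_mult power_mult_distrib)
  also have "ring_cong (of_nat q) \<dots> (eis_cnj (z ^ 3 * \<alpha>) ^ n)"
    using t unfolding z_def by (rule ring_cong_power)
  also have "eis_cnj (z ^ 3 * \<alpha>) ^ n = eis_cnj z ^ (3 * n) * eis_cnj \<alpha> ^ n"
    by (simp add: power_mult power_mult_distrib)
  also have "ring_cong (of_nat q) \<dots> (1 * eis_cnj \<alpha> ^ n)"
    by (intro ring_cong_mult 2 ring_cong_refl)
  finally show ?thesis by simp
qed

text \<open>Since \<open>2 * \<gamma> = (2 * c - d) + d * theta\<close>, dividing by
  \<open>d\<close> gives \<open>t + theta\<close>. Conjugation fixes rational factors, so rescaling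
  by units preserves the congruence.\<close>

lemma cubic_if_omega_coord:
  assumes d: "\<not> int q dvd d" and \<gamma>: "\<gamma> = of_int c + of_int d * omega"
    and cong: "ring_cong (of_nat q) (\<gamma> ^ 3 * \<alpha>) (eis_cnj (\<gamma> ^ 3 * \<alpha>))"
  shows "\<exists>t. ring_cong (of_nat q) ((of_int t + theta) ^ 3 * \<alpha>) (eis_cnj ((of_int t + theta) ^ 3 * \<alpha>))"
proof -
  obtain d' where d': "[d * d' = 1] (mod int q)" by (rule int_prime_inverse[OF q d])
  then have dd: "ring_cong (of_nat q) (of_int d * of_int d' :: eisenstein) 1"
    using ring_cong_of_int[OF d', where 'a = eisenstein] by simp
  define t where "t = (2 * c - d) * d'"
  let ?z = "of_int t + theta"
  have "of_int d * ?z = of_int (2 * c - d) * (of_int d * of_int d') + of_int d * theta"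
    by (simp add: t_def algebra_simps)
  also have "ring_cong (of_nat q) \<dots> (of_int (2 * c - d) * 1 + of_int d * theta)"
    by (intro ring_cong_add ring_cong_mult_left dd ring_cong_refl)
  also have "of_int (2 * c - d) * 1 + of_int d * theta = 2 * \<gamma>"
    by (simp add: \<gamma> theta_def algebra_simps)
  finally have "ring_cong (of_nat q) ((of_int d * ?z) ^ 3 * \<alpha>) ((2 * \<gamma>) ^ 3 * \<alpha>)"
    by (intro ring_cong_mult[OF ring_cong_power ring_cong_refl])
  then have 1: "ring_cong (of_nat q) (of_int d ^ 3 * (?z ^ 3 * \<alpha>)) (8 * (\<gamma> ^ 3 * \<alpha>))"
    by (simp add: power_mult_distrib mult.assoc)
  then have "ring_cong (of_nat q) (eis_cnj (of_int d ^ 3 * (?z ^ 3 * \<alpha>))) (eis_cnj (8 * (\<gamma> ^ 3 * \<alpha>)))"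
    by (rule ring_cong_cnj[of "int q", unfolded of_int_of_nat_eq])
  then have 2: "ring_cong (of_nat q) (of_int d ^ 3 * eis_cnj (?z ^ 3 * \<alpha>)) (8 * eis_cnj (\<gamma> ^ 3 * \<alpha>))"
    by simp
  have "ring_cong (of_nat q) (of_int d ^ 3 * (?z ^ 3 * \<alpha>)) (8 * eis_cnj (\<gamma> ^ 3 * \<alpha>))"
    by (rule ring_cong_trans[OF 1 ring_cong_mult_left[OF cong]])
  then have "ring_cong (of_nat q) (of_int d ^ 3 * (?z ^ 3 * \<alpha>)) (of_int d ^ 3 * eis_cnj (?z ^ 3 * \<alpha>))"
    by (rule ring_cong_trans[OF _ ring_cong_sym[OF 2]])
  moreover have "ring_cong (of_nat q) (of_int d ^ 3 * of_int d' ^ 3 :: eisenstein) 1"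
    using ring_cong_power[OF dd, of 3] by (simp add: power_mult_distrib)
  ultimately have "ring_cong (of_nat q) (?z ^ 3 * \<alpha>) (eis_cnj (?z ^ 3 * \<alpha>))"
    using ring_cong_cancel by blast
  then show ?thesis by blast
qed

lemma cubic_if_ring_cong_power_cnj:
  assumes n: "3 * n = q\<^sup>2 - 1" "\<not> 3 dvd n" and \<alpha>: "\<not> q dvd eis_norm \<alpha>"
    and cong: "ring_cong (of_nat q) (\<alpha> ^ n) (eis_cnj \<alpha> ^ n)"
  shows "\<exists>t. ring_cong (of_nat q) ((of_int t + theta) ^ 3 * \<alpha>) (eis_cnj ((of_int t + theta) ^ 3 * \<alpha>))"
proof -
  define m where "m = n div 3"
  \<comment> \<open>\<open>e\<close> is an inverse of 3 modulo \<open>n\<close>; the bound on it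
    serves to show that \<open>\<beta>\<close> is nonzero modulo \<open>q\<close>.\<close>
  have "\<exists>e j. 3 * e = 1 + n * j \<and> e \<le> n"
  proof (cases "n mod 3 = 1")
    case True
    then have "n = 3 * m + 1" unfolding m_def by presburger
    then have "3 * (2 * m + 1) = 1 + n * 2 \<and> 2 * m + 1 \<le> n" by simp
    then show ?thesis by blast
  next
    case False
    then have "n = 3 * m + 2" using n(2) unfolding m_def by presburger
    then have "3 * (m + 1) = 1 + n * 1 \<and> m + 1 \<le> n" by simp
    then show ?thesis by blast
  qed
  then obtain e j where e: "3 * e = 1 + n * j" "e \<le> n" by blast
  then have "e \<le> q\<^sup>2" using n by linarith
  \<comment> \<open>\<open>\<beta>\<close> is a rational multiple of the wanted \<open>t + \<theta>\<close>, except that \<open>t\<close> may be infinite; then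
    multiplying by \<open>\<omega>\<close> leaves the cube unchanged and makes \<open>t\<close> finite.\<close>
  define \<beta> where "\<beta> = eis_cnj \<alpha> ^ e"
  have "\<beta> ^ 3 = eis_cnj \<alpha> ^ (e * 3)" by (simp add: \<beta>_def power_mult)
  also have "e * 3 = 1 + n * j" using e by simp
  finally have b3: "\<beta> ^ 3 = eis_cnj \<alpha> * (eis_cnj \<alpha> ^ n) ^ j" by (simp add: power_mult)
  \<comment> \<open>\<open>\<beta> ^ 3 * \<alpha>\<close> is the norm of \<open>\<alpha>\<close>
    times a power of \<open>eis_cnj \<alpha> ^ n\<close>, so the hypothesis makes it
    self-conjugate.\<close>
  have "ring_cong (of_nat q) ((eis_cnj \<alpha> ^ n) ^ j * (\<alpha> * eis_cnj \<alpha>)) ((\<alpha> ^ n) ^ j * (\<alpha> * eis_cnj \<alpha>))"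
    by (intro ring_cong_mult ring_cong_power ring_cong_sym[OF cong] ring_cong_refl)
  then have \<beta>: "ring_cong (of_nat q) (\<beta> ^ 3 * \<alpha>) (eis_cnj (\<beta> ^ 3 * \<alpha>))"
    by (simp add: b3 mult_ac)
  have "(\<beta> * omega) ^ 3 = \<beta> ^ 3" by (simp add: power_mult_distrib omega_cube)
  then have \<beta>\<omega>: "ring_cong (of_nat q) ((\<beta> * omega) ^ 3 * \<alpha>) (eis_cnj ((\<beta> * omega) ^ 3 * \<alpha>))"
    using \<beta> by simp
  obtain c d where cd: "\<beta> = of_int c + of_int d * omega" by (rule eisenstein_cases)
  have "\<beta> * omega = of_int c * omega + of_int d * (omega * omega)" by (simp add: cd algebra_simps)
  then have cd': "\<beta> * omega = of_int (- d) + of_int (c - d) * omega"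
    unfolding omega_square by (simp add: algebra_simps)
  have "\<not> of_nat q dvd \<beta>"
  proof
    assume "of_nat q dvd \<beta>"
    then have "ring_cong (of_nat q) (eis_cnj \<alpha> ^ e) 0" by (simp add: \<beta>_def ring_cong_def)
    then have "ring_cong (of_nat q) (eis_cnj \<alpha>) 0"
      using eis_cong_0_of_power[OF q three_not_dvd_q \<open>e \<le> q\<^sup>2\<close>] by blast
    then have "of_nat q dvd \<alpha> * eis_cnj \<alpha>" by (simp add: ring_cong_def)
    then have "of_int (int q) dvd (of_int (int (eis_norm \<alpha>)) :: eisenstein)"
      by (simp add: eis_norm_correct)
    then show False using \<alpha> unfolding of_int_dvd_of_int_eis_iff by simp
  qed
  then have "\<not> (int q dvd d \<and> int q dvd c)"
    using of_int_dvd_eis_iff[of "int q" c d] unfolding cd by auto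
  \<comment> \<open>These are the \<open>omega\<close>-coordinates of \<open>\<beta>\<close> and
    \<open>\<beta> * omega\<close>; if \<open>q\<close> divided both, it would divide
    \<open>\<beta>\<close>.\<close>
  then consider "\<not> int q dvd d" | "\<not> int q dvd c - d" using dvd_add[of "int q" "c - d" d] by fastforce
  then show ?thesis
    by cases (use cubic_if_omega_coord[OF _ cd \<beta>] cubic_if_omega_coord[OF _ cd' \<beta>\<omega>] in blast)+
qed

text \<open>The two terms are swapped by negating \<open>\<theta>\<close>, so only odd powers of it
  remain, and these reduce by \<open>\<theta> * \<theta> = -3\<close>.\<close>

lemma cubic_identity:
  fixes t l m \<theta> :: "'a::idom"
  assumes "\<theta> * \<theta> = -3"
  shows "(t + \<theta>) ^ 3 * ((l + 3 * m * \<theta>) * (\<theta> - 1)) - (t - \<theta>) ^ 3 * ((l - 3 * m * \<theta>) * (- \<theta> - 1))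
    = 2 * \<theta> * ((t ^ 3 - 3 * t\<^sup>2 - 9 * t + 3) * l - 3 * (t ^ 3 + 9 * t\<^sup>2 - 9 * t - 9) * m)"
proof -
  have "(t + \<theta>) ^ 3 * ((l + 3 * m * \<theta>) * (\<theta> - 1)) - (t - \<theta>) ^ 3 * ((l - 3 * m * \<theta>) * (- \<theta> - 1))
      = 2 * \<theta> * ((t ^ 3 + 3 * t * (\<theta> * \<theta>)) * (l - 3 * m) + (3 * t\<^sup>2 + \<theta> * \<theta>) * (3 * m * (\<theta> * \<theta>) - l))"
    by (simp add: power2_eq_square power3_eq_cube algebra_simps)
  also have "\<dots> = 2 * \<theta> * ((t ^ 3 - 3 * t\<^sup>2 - 9 * t + 3) * l - 3 * (t ^ 3 + 9 * t\<^sup>2 - 9 * t - 9) * m)"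
    unfolding assms by (simp add: algebra_simps)
  finally show ?thesis .
qed

lemma cubic_cong_iff:
  fixes t l m :: int
  assumes \<rho>: "2 * \<rho> = of_int l + 3 * of_int m * theta"
  shows "ring_cong (of_nat q) ((of_int t + theta) ^ 3 * (\<rho> * omega))
      (eis_cnj ((of_int t + theta) ^ 3 * (\<rho> * omega)))
    \<longleftrightarrow> [(t ^ 3 - 3 * t\<^sup>2 - 9 * t + 3) * l = 3 * (t ^ 3 + 9 * t\<^sup>2 - 9 * t - 9) * m] (mod int q)"
proof -
  define E where "E = (t ^ 3 - 3 * t\<^sup>2 - 9 * t + 3) * l - 3 * (t ^ 3 + 9 * t\<^sup>2 - 9 * t - 9) * m"
  let ?z = "(of_int t + theta) ^ 3 * (\<rho> * omega)"
  have "4 * ?z = (of_int t + theta) ^ 3 * ((2 * \<rho>) * (2 * omega))" by (simp add: mult_ac)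
  then have z: "4 * ?z = (of_int t + theta) ^ 3 * ((of_int l + 3 * of_int m * theta) * (theta - 1))"
    unfolding \<rho> two_omega .
  have "4 * eis_cnj ?z = eis_cnj (4 * ?z)" by simp
  also have "\<dots> = (of_int t - theta) ^ 3 * ((of_int l - 3 * of_int m * theta) * (- theta - 1))"
    unfolding z by simp
  finally have z': "4 * eis_cnj ?z = \<dots>" .
  have "4 * (?z - eis_cnj ?z) = 4 * ?z - 4 * eis_cnj ?z" by (simp add: right_diff_distrib)
  also have "\<dots> = 2 * theta * of_int E"
    unfolding z z' E_def using cubic_identity[OF theta_square, of "of_int t" "of_int l" "of_int m"] by simp
  also have "\<dots> = of_int (2 * E) + of_int (2 * (2 * E)) * omega"
    by (simp add: theta_def algebra_simps)
  finally have "of_nat q dvd 4 * (?z - eis_cnj ?z) \<longleftrightarrow> int q dvd 2 * E \<and> int q dvd 2 * (2 * E)"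
    using of_int_dvd_eis_iff[of "int q" "2 * E" "2 * (2 * E)"] by simp
  then have "of_nat q dvd ?z - eis_cnj ?z \<longleftrightarrow> int q dvd E"
    unfolding q_dvd_mult_4 q_dvd_int_mult using q_not_dvd_int by blast
  then show ?thesis unfolding ring_cong_def cong_iff_dvd_diff E_def .
qed

end

section \<open>Residue classes modulo 9 and the two criteria\<close>

theorem proposition6:
  fixes p q :: nat and L M :: int
  assumes "prime q" and "q > 3"
    and "prime p" and "[p = 1] (mod 3)" and "p \<noteq> q"
    and "4 * int p = L\<^sup>2 + 27 * M\<^sup>2"
  shows "([int q = 2] (mod 9) \<or> [int q = -2] (mod 9) \<longrightarrow>
      (F_char q L M = omega \<longleftrightarrow>
        (\<exists>t :: int. [(t ^ 3 - 3 * t\<^sup>2 - 9 * t + 3) * L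
                     = -3 * (t ^ 3 + 9 * t\<^sup>2 - 9 * t - 9) * M] (mod int q))))
    \<and> ([int q = 4] (mod 9) \<or> [int q = -4] (mod 9) \<longrightarrow>
      (F_char q L M = omega \<longleftrightarrow>
        (\<exists>t :: int. [(t ^ 3 - 3 * t\<^sup>2 - 9 * t + 3) * L
                     = 3 * (t ^ 3 + 9 * t\<^sup>2 - 9 * t - 9) * M] (mod int q))))"
proof -
  define \<pi> where "\<pi> = LM_prime L M"
  have norm: "eis_norm \<pi> = p" and ev: "even (L + 3 * M)"
    using eis_norm_LM_prime[OF assms(6)] by (simp_all add: \<pi>_def)
  interpret cubic_residue p \<pi>
    using assms(3,4) norm by unfold_locales
  define c where "c = X (int q)"
  have F: "F_char q L M = c" by (simp add: F_char_def c_def X_def flip: \<pi>_def)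
  define n where "n = (q\<^sup>2 - 1) div 3"
  have nd: "\<not> int p dvd int q" using assms primes_dvd_imp_eq[of p q] by auto
  then have c3: "c ^ 3 = 1" unfolding c_def by (rule X_cube)
  have q3: "\<not> 3 dvd q" using assms(1,2) by (rule three_not_dvd_q)
  have n: "3 * n = q\<^sup>2 - 1"
  proof -
    have "q mod 3 = 1 \<or> q mod 3 = 2" using q3 by presburger
    then have "(q mod 3)\<^sup>2 mod 3 = 1" by auto
    then have "q\<^sup>2 mod 3 = 1" by (simp add: power_mod)
    then show ?thesis unfolding n_def by presburger
  qed
  have pi: "\<pi> = of_int ((L + 3 * M) div 2) + of_int (3 * M) * omega"
    by (simp add: \<pi>_def LM_prime_def)
  have recip: "ring_cong (of_nat q) (c * \<pi> ^ n) (eis_cnj \<pi> ^ n)"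
    unfolding c_def by (rule rational_cubic_reciprocity[OF pi _ assms(1,2) assms(5)[symmetric] n]) simp
  have "\<not> q dvd p" using assms primes_dvd_imp_eq[of q p] by auto
  then have qp: "\<not> q dvd eis_norm \<pi>" "\<not> q dvd eis_norm (\<pi> * omega)" "\<not> q dvd eis_norm (eis_cnj \<pi> * omega)"
    using norm by (simp_all add: eis_norm_mult eis_norm_cnj eis_norm_omega)
  \<comment> \<open>\<open>\<pi> ^ n\<close> is a unit modulo \<open>q\<close>, and cube roots of
    unity stay distinct modulo \<open>q\<close>.\<close>
  have key: "ring_cong (of_nat q) (\<pi> ^ n * omega ^ 2) (c * \<pi> ^ n * omega) \<longleftrightarrow> c = omega"
  proof
    assume "ring_cong (of_nat q) (\<pi> ^ n * omega ^ 2) (c * \<pi> ^ n * omega)"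
    then have *: "ring_cong (of_nat q) (\<pi> ^ n * omega ^ 2) (\<pi> ^ n * (c * omega))" by (simp add: mult_ac)
    obtain y where "ring_cong (of_nat q) (\<pi> * y) 1" using eis_unit_mod[OF assms(1) qp(1)] .
    then have "ring_cong (of_nat q) (\<pi> ^ n * y ^ n) 1"
      using ring_cong_power[of "of_nat q" "\<pi> * y" 1 n] by (simp add: power_mult_distrib)
    then have "ring_cong (of_nat q) (omega ^ 2) (c * omega)" using * by (rule ring_cong_cancel)
    then have "omega ^ 2 = c * omega"
      using eis_cube_root_unique_mod[of "omega ^ 2" "c * omega" "int q"] c3 q_not_dvd_int[OF assms(1,2)]
      by (simp add: power_mult_distrib omega_cube omega_power_mod[of 6] flip: power_mult)
    moreover have "omega \<noteq> 0" using omega_cube by auto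
    ultimately show "c = omega" by (simp add: power2_eq_square)
  qed (simp add: power2_eq_square mult_ac)
  have "2 * \<pi> = of_int (2 * ((L + 3 * M) div 2)) + 3 * of_int M * (2 * omega)"
    by (simp add: pi algebra_simps)
  also have "2 * ((L + 3 * M) div 2) = L + 3 * M" using ev by simp
  finally have pi2: "2 * \<pi> = of_int L + 3 * of_int M * theta"
    unfolding two_omega by (simp add: algebra_simps)
  have "2 * eis_cnj \<pi> = eis_cnj (2 * \<pi>)" by simp
  also have "\<dots> = of_int L + 3 * of_int (- M) * theta" unfolding pi2 by simp
  finally have pi2': "2 * eis_cnj \<pi> = of_int L + 3 * of_int (- M) * theta" .
  \<comment> \<open>The two right-hand sides differ by the sign of \<open>M\<close>, that is, by
    \<open>\<pi>\<close> against its conjugate.\<close>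
  have crit: "(\<exists>t. [(t ^ 3 - 3 * t\<^sup>2 - 9 * t + 3) * L = 3 * (t ^ 3 + 9 * t\<^sup>2 - 9 * t - 9) * m] (mod int q))
      \<longleftrightarrow> ring_cong (of_nat q) ((\<rho> * omega) ^ n) (eis_cnj (\<rho> * omega) ^ n)"
    if "\<not> 3 dvd n" "\<not> q dvd eis_norm (\<rho> * omega)" "2 * \<rho> = of_int L + 3 * of_int m * theta" for \<rho> m
    using cubic_cong_iff[OF assms(1,2) that(3)] ring_cong_power_cnj_if_cubic[OF assms(1,2) n that(2)]
      cubic_if_ring_cong_power_cnj[OF assms(1,2) n that(1,2)] by blast
  have neg: "3 * P * (- M) = -3 * P * M" for P
    by simp
  show ?thesis
  proof (intro conjI impI)
    assume "[int q = 2] (mod 9) \<or> [int q = -2] (mod 9)"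
    then have "int (q mod 9) = int 2 \<or> int (q mod 9) = int 7"
      by (auto simp: cong_def zmod_int)
    then have "q mod 9 = 2 \<or> q mod 9 = 7" unfolding of_nat_eq_iff .
    then have "(q mod 9)\<^sup>2 mod 9 = 4" by auto
    then have "q\<^sup>2 mod 9 = 4" by (simp add: power_mod)
    then have "q\<^sup>2 = 9 * (q\<^sup>2 div 9) + 4" by (metis mult_div_mod_eq)
    \<comment> \<open>\<open>q\<^sup>2 \<equiv> 4\<close> modulo 9 gives \<open>n \<equiv> 1\<close>
      modulo 3, which fixes \<open>omega ^ n\<close>.\<close>
    then have "n = 3 * (q\<^sup>2 div 9) + 1" using n by linarith
    then obtain j where j: "n = 3 * j + 1" by blast
    have n1: "n mod 3 = 1" and "(2 * n) mod 3 = 2" unfolding j by presburger+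
    then have w: "omega ^ n = omega" "omega ^ (2 * n) = omega ^ 2"
      using n1 omega_power_mod[of n] omega_power_mod[of "2 * n"] by simp_all
    have "(\<exists>t. [(t ^ 3 - 3 * t\<^sup>2 - 9 * t + 3) * L = 3 * (t ^ 3 + 9 * t\<^sup>2 - 9 * t - 9) * (- M)] (mod int q))
      \<longleftrightarrow> ring_cong (of_nat q) (eis_cnj \<pi> ^ n * omega) (\<pi> ^ n * omega ^ 2)"
      by (subst crit[OF _ qp(3) pi2'])
        (use n1 w in \<open>auto simp: power_mult_distrib eis_cnj_omega_square simp flip: power_mult\<close>)
    \<comment> \<open>Reciprocity replaces \<open>eis_cnj \<pi> ^ n\<close> by
      \<open>c * \<pi> ^ n\<close>, leading to the form in \<open>key\<close>.\<close>
    also have "\<dots> \<longleftrightarrow> ring_cong (of_nat q) (\<pi> ^ n * omega ^ 2) (c * \<pi> ^ n * omega)"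
      using ring_cong_mult[OF recip ring_cong_refl[of _ omega]]
      by (meson ring_cong_sym ring_cong_trans)
    finally show "F_char q L M = omega \<longleftrightarrow> (\<exists>t :: int. [(t ^ 3 - 3 * t\<^sup>2 - 9 * t + 3) * L
                     = -3 * (t ^ 3 + 9 * t\<^sup>2 - 9 * t - 9) * M] (mod int q))"
      unfolding key F neg by blast
  next
    assume "[int q = 4] (mod 9) \<or> [int q = -4] (mod 9)"
    then have "int (q mod 9) = int 4 \<or> int (q mod 9) = int 5"
      by (auto simp: cong_def zmod_int)
    then have "q mod 9 = 4 \<or> q mod 9 = 5" unfolding of_nat_eq_iff .
    then have "(q mod 9)\<^sup>2 mod 9 = 7" by auto
    then have "q\<^sup>2 mod 9 = 7" by (simp add: power_mod)
    then have "q\<^sup>2 = 9 * (q\<^sup>2 div 9) + 7" by (metis mult_div_mod_eq)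
    \<comment> \<open>Now \<open>n \<equiv> 2\<close> modulo 3, so \<open>omega ^ n\<close> is
      conjugated; using \<open>\<pi>\<close> in place of its conjugate leads to the same
      form.\<close>
    then have "n = 3 * (q\<^sup>2 div 9) + 2" using n by linarith
    then obtain j where j: "n = 3 * j + 2" by blast
    have n2: "n mod 3 = 2" and "(2 * n) mod 3 = 1" unfolding j by presburger+
    then have w: "omega ^ n = omega ^ 2" "omega ^ (2 * n) = omega"
      using n2 omega_power_mod[of n] omega_power_mod[of "2 * n"] by simp_all
    have "(\<exists>t. [(t ^ 3 - 3 * t\<^sup>2 - 9 * t + 3) * L = 3 * (t ^ 3 + 9 * t\<^sup>2 - 9 * t - 9) * M] (mod int q))
      \<longleftrightarrow> ring_cong (of_nat q) (\<pi> ^ n * omega ^ 2) (eis_cnj \<pi> ^ n * omega)"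
      by (subst crit[OF _ qp(2) pi2])
        (use n2 w in \<open>auto simp: power_mult_distrib eis_cnj_omega_square simp flip: power_mult\<close>)
    also have "\<dots> \<longleftrightarrow> ring_cong (of_nat q) (\<pi> ^ n * omega ^ 2) (c * \<pi> ^ n * omega)"
      using ring_cong_mult[OF recip ring_cong_refl[of _ omega]]
      by (meson ring_cong_sym ring_cong_trans)
    finally show "F_char q L M = omega \<longleftrightarrow> (\<exists>t :: int. [(t ^ 3 - 3 * t\<^sup>2 - 9 * t + 3) * L
                     = 3 * (t ^ 3 + 9 * t\<^sup>2 - 9 * t - 9) * M] (mod int q))"
      unfolding key F by blast
  qed
qed

end
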